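(* Let $\mathcal{Q}$ be a right-basic set operad (finite in each arity, with $\mathcal{Q}(0)=\varnothing$ and $\mathcal{Q}(1)=\{*\}$). Then the poset species $\Pi^{\mathcal{Q}}$ of right-$\mathcal{Q}$-decorated partitions, equipped with the forgetful morphism $a:\Pi^{\mathcal{Q}}\to\Pi$, $(\pi,\xi)\mapsto\pi$, and with the morphisms $\varphi_{(\pi,\xi)}$ and $\psi_{(\pi,\xi)}$ described in the context, is an operadic poset species.
   Context: All finite sets $S$ are non-empty. $\Pi(S)$ is the poset of partitions of $S$, with $\alpha\le\beta$ iff $\alpha$ is obtained by merging blocks of $\beta$. For $T\subset S$, $\pi_{|T}$ is the set of blocks of $\pi$ contained in $T$. There are isomorphisms $\varphi_\pi:\Pi_{\le\pi}(S)\to\Pi(\pi)$, $\alpha\mapsto\{\pi_{|A},A\in\alpha\}$, and $\psi_\pi:\Pi_{\ge\pi}(S)\to\prod_{T\in\pi}\Pi(T)$, $\beta\mapsto(\beta_{|T})_{T\in\pi}$ (a partition is identified with its set of blocks). Right-decorated partitions. A right-$\mathcal{Q}$-decorated partition of $S$ is a pair $(\pi,\xi)$ with $\pi\in\Pi(S)$ and $\xi=(\xi_T)_{T\in\pi}$, $\xi_T\in\mathcal{Q}(T)$; $\Pi^{\mathcal{Q}}(S)$ is the set of those, ordered by: $(\alpha,\eta)\le(\beta,\xi)$ iff $\alpha\le\beta$ and for every $A\in\alpha$ there exists $\nu_A\in\mathcal{Q}(\beta_{|A})$ with $\eta_A=\nu_A\circ(\xi_B)_{B\in\beta_{|A}}$.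 The operad $\mathcal{Q}$ is right-basic if for every finite set $S$ and every right-$\mathcal{Q}$-decorated partition $(\pi,\xi)$ of $S$, the map $\mathcal{Q}(\pi)\to\mathcal{Q}(S)$, $\nu\mapsto\nu\circ(\xi_T)_{T\in\pi}$ is injective. The morphism $\varphi_{(\pi,\xi)}:\Pi^{\mathcal{Q}}_{\le(\pi,\xi)}(S)\to\Pi^{\mathcal{Q}}(\pi)$ sends $(\alpha,\eta)$ to the partition $\{\pi_{|A},A\in\alpha\}$ of $\pi$ decorated by the unique elements $\nu_A\in\mathcal{Q}(\pi_{|A})$ such that $\eta_A=\nu_A\circ(\xi_T)_{T\in\pi_{|A}}$. The morphism $\psi_{(\pi,\xi)}:\Pi^{\mathcal{Q}}_{\ge(\pi,\xi)}(S)\to\prod_{T\in\pi}\Pi^{\mathcal{Q}}(T)$ sends $(\beta,\nu)$ to the family of partitions $\beta_{|T}$, $T\in\pi$, with the decorations given by $\nu$. Operadic poset species. A poset species is a functor from finite sets and bijections to (finite) posets. An operadic poset species is a poset species $P$ with a morphism of poset species $a:P\to\Pi$ such that $a^{-1}(\min\Pi(S))=\min P(S)$ and $a^{-1}(\max\Pi(S))=\max P(S)$ for all $S$ (sets of minimal/maximal elements), and, for all $S$ and $x\in P(S)$ with $a(x)=\pi$, morphisms of posets $\varphi_x:P_{\le x}(S)\to P(\pi)$ and $\psi_x:P_{\ge x}(S)\to\prod_{T\in\pi}P(T)$ with $a\circ\varphi_x=\varphi_\pi\circ a$ and $a\circ\psi_x=\psi_\pi\circ a$, satisfying: (Equivariance)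 For a bijection $f:S\to S'$, $x\in P(S)$, $x'=P(f)(x)$, $\pi=a(x)$, $\pi'=a(x')$, and the induced bijections $f:\pi\to\pi'$, $f_{|T}:T\to f(T)$: $P(f)\circ\varphi_x=\varphi_{x'}\circ P(f)$ and $(P(f_{|T}))_{T\in\pi}\circ\psi_x=\psi_{x'}\circ P(f)$. (Unitality) $P(\{s\})$ is a singleton for every singleton $\{s\}$. (Associativity) Let $x\le x'$ in $P(S)$, $\pi=a(x)$, $\pi'=a(x')$, $\underline{x}=\varphi_{x'}(x)\in P(\pi')$, $(x'_{|T})_{T\in\pi}=\psi_x(x')$; identify $\pi$ with the partition $\{\pi'_{|T},T\in\pi\}$ of $\pi'$. Then $\varphi_{\underline{x}}\circ\varphi_{x'}=\varphi_x$ on $P_{\le x}(S)$; $(\psi_{x'_{|T}})_{T\in\pi}\circ\psi_x=\psi_{x'}$ on $P_{\ge x'}(S)$; and $\psi_{\underline{x}}\circ\varphi_{x'}=(\varphi_{x'_{|T}})_{T\in\pi}\circ\psi_x$ as maps $P_{[x,x']}(S)\to\prod_{T\in\pi}P(\pi'_{|T})$.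
   Formalization: The operad Q is additionally assumed non-empty in every arity n ≥ 1; without this the claim fails (e.g. for the operad with only the unit), since nothing then lies over the minimal partition {S}. *)

theory Defs
  imports "HOL-Library.FSet" "HOL-Library.FuncSet" "HOL-Library.Disjoint_Sets"
begin

section \<open>Finite sets whose blocks are again points\<close>

text \<open>
  A partition of a finite set \<open>S\<close> has to be itself a finite set at which species can be evaluated.
  All finite sets are therefore taken inside a universe that is closed under forming finite sets:
  the hereditarily finite sets over an arbitrary type of atoms.  The point that stands for the
  finite set \<open>T\<close> is \<open>blk T\<close>, and \<open>blk\<close> is injective on finite sets.
\<close>

datatype 'a hfin = Atom 'a | Block "'a hfin fset"

definition blk :: "'a hfin set \<Rightarrow> 'a hfin" where
  "blk T = Block (Abs_fset T)"

text \<open>The bijection \<open>\<pi> \<rightarrow> \<pi>'\<close> of sets of blocks induced by a bijection \<open>f\<close>, i.e.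
  \<open>blk T \<mapsto> blk (f ` T)\<close>.\<close>

definition blk_map :: "('a hfin \<Rightarrow> 'a hfin) \<Rightarrow> 'a hfin \<Rightarrow> 'a hfin" where
  "blk_map f b = (case b of Atom a \<Rightarrow> Atom a | Block F \<Rightarrow> blk (f ` fset F))"

definition fin_set :: "'a set \<Rightarrow> bool" where
  "fin_set S \<longleftrightarrow> finite S \<and> S \<noteq> {}"


section \<open>Partitions\<close>

text \<open>The partition \<open>\<pi>\<close>, regarded as a finite set.\<close>

definition pts :: "'a hfin set set \<Rightarrow> 'a hfin set" where
  "pts \<pi> = blk ` \<pi>"

text \<open>\<open>\<pi>\<^sub>|\<^sub>T\<close>\<close>

definition blocks_in :: "'a set set \<Rightarrow> 'a set \<Rightarrow> 'a set set" where
  "blocks_in \<pi> T = {B \<in> \<pi>. B \<subseteq> T}"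

definition singletons :: "'a set \<Rightarrow> 'a set set" where
  "singletons S = (\<lambda>s. {s}) ` S"

text \<open>\<open>\<phi>\<^sub>\<pi>(\<alpha>) = {\<pi>\<^sub>|\<^sub>A. A \<in> \<alpha>}\<close>, a partition of \<open>pts \<pi>\<close>.\<close>

definition part_phi :: "'a hfin set set \<Rightarrow> 'a hfin set set \<Rightarrow> 'a hfin set set" where
  "part_phi \<pi> \<alpha> = (\<lambda>A. pts (blocks_in \<pi> A)) ` \<alpha>"

text \<open>\<open>\<psi>\<^sub>\<pi>(\<beta>) = (\<beta>\<^sub>|\<^sub>T)\<close>, \<open>T \<in> \<pi>\<close>.\<close>

definition part_psi :: "'a set set \<Rightarrow> 'a set set \<Rightarrow> 'a set \<Rightarrow> 'a set set" where
  "part_psi \<pi> \<beta> = (\<lambda>T\<in>\<pi>. blocks_in \<beta> T)"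

text \<open>For \<open>\<alpha> \<le> \<pi>\<close>, the bijection \<open>A \<mapsto> \<pi>\<^sub>|\<^sub>A\<close> that identifies \<open>\<alpha>\<close> with the partition
  \<open>{\<pi>\<^sub>|\<^sub>A. A \<in> \<alpha>}\<close> of \<open>\<pi>\<close>; on points, \<open>blk A \<mapsto> blk (pts (\<pi>\<^sub>|\<^sub>A))\<close>.\<close>

definition ident :: "'a hfin set set \<Rightarrow> 'a hfin \<Rightarrow> 'a hfin" where
  "ident \<pi> b = (case b of Atom a \<Rightarrow> Atom a | Block F \<Rightarrow> blk (pts (blocks_in \<pi> (fset F))))"


section \<open>Poset species\<close>

text \<open>\<open>trans_map P S f\<close> is \<open>P(f) : P(S) \<rightarrow> P(S')\<close> for the bijection \<open>f : S \<rightarrow> S'\<close>; bijections out of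
  \<open>S\<close> are functions that are injective on \<open>S\<close>, and \<open>S' = f ` S\<close>.\<close>

record ('a, 'p) poset_species_data =
  elems :: "'a hfin set \<Rightarrow> 'p set"
  leq :: "'a hfin set \<Rightarrow> 'p rel"
  trans_map :: "'a hfin set \<Rightarrow> ('a hfin \<Rightarrow> 'a hfin) \<Rightarrow> 'p \<Rightarrow> 'p"

definition poset_hom :: "'p set \<Rightarrow> 'p rel \<Rightarrow> 'q set \<Rightarrow> 'q rel \<Rightarrow> ('p \<Rightarrow> 'q) \<Rightarrow> bool" where
  "poset_hom A r B s h \<longleftrightarrow>
     h \<in> A \<rightarrow> B \<and> monotone_on A (\<lambda>x y. (x, y) \<in> r) (\<lambda>x y. (x, y) \<in> s) h"

locale poset_species =
  fixes P :: "('a, 'p) poset_species_data"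
  assumes finite_elems: "fin_set S \<Longrightarrow> finite (elems P S)"
    and partial_order: "fin_set S \<Longrightarrow> partial_order_on (elems P S) (leq P S)"
    and trans_map_hom: "\<lbrakk>fin_set S; inj_on f S\<rbrakk> \<Longrightarrow>
          poset_hom (elems P S) (leq P S) (elems P (f ` S)) (leq P (f ` S)) (trans_map P S f)"
    and trans_map_cong: "\<lbrakk>fin_set S; inj_on f S; \<And>s. s \<in> S \<Longrightarrow> f s = g s; x \<in> elems P S\<rbrakk> \<Longrightarrow>
          trans_map P S f x = trans_map P S g x"
    and trans_map_id: "\<lbrakk>fin_set S; x \<in> elems P S\<rbrakk> \<Longrightarrow> trans_map P S id x = x"
    and trans_map_comp: "\<lbrakk>fin_set S; inj_on f S; inj_on g (f ` S); x \<in> elems P S\<rbrakk> \<Longrightarrow>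
          trans_map P S (g \<circ> f) x = trans_map P (f ` S) g (trans_map P S f x)"

definition poset_species_hom ::
  "('a, 'p) poset_species_data \<Rightarrow> ('a, 'q) poset_species_data \<Rightarrow> ('a hfin set \<Rightarrow> 'p \<Rightarrow> 'q) \<Rightarrow> bool"
where
  "poset_species_hom P R h \<longleftrightarrow>
     (\<forall>S. fin_set S \<longrightarrow>
        poset_hom (elems P S) (leq P S) (elems R S) (leq R S) (h S) \<and>
        (\<forall>f. inj_on f S \<longrightarrow> (\<forall>x\<in>elems P S. h (f ` S) (trans_map P S f x) = trans_map R S f (h S x))))"

text \<open>The order is opposite to refinement: \<open>\<alpha> \<le> \<beta>\<close> iff \<open>\<beta>\<close> refines \<open>\<alpha>\<close>.\<close>

definition Part :: "('a, 'a hfin set set) poset_species_data" where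
  "Part = \<lparr> elems = (\<lambda>S. {\<pi>. partition_on S \<pi>}),
            leq = (\<lambda>S. {(\<alpha>, \<beta>). refines S \<beta> \<alpha>}),
            trans_map = (\<lambda>S f \<pi>. (`) f ` \<pi>) \<rparr>"

definition minimals :: "('a, 'p) poset_species_data \<Rightarrow> 'a hfin set \<Rightarrow> 'p set" where
  "minimals P S = {x \<in> elems P S. \<forall>y\<in>elems P S. (y, x) \<in> leq P S \<longrightarrow> y = x}"

definition maximals :: "('a, 'p) poset_species_data \<Rightarrow> 'a hfin set \<Rightarrow> 'p set" where
  "maximals P S = {x \<in> elems P S. \<forall>y\<in>elems P S. (x, y) \<in> leq P S \<longrightarrow> y = x}"

definition lower :: "('a, 'p) poset_species_data \<Rightarrow> 'a hfin set \<Rightarrow> 'p \<Rightarrow> 'p set" where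
  "lower P S x = {y \<in> elems P S. (y, x) \<in> leq P S}"

definition upper :: "('a, 'p) poset_species_data \<Rightarrow> 'a hfin set \<Rightarrow> 'p \<Rightarrow> 'p set" where
  "upper P S x = {y \<in> elems P S. (x, y) \<in> leq P S}"

text \<open>The product poset \<open>\<Prod>\<^sub>T P(T)\<close>, \<open>T \<in> \<pi>\<close>.\<close>

definition prod_elems ::
  "('a, 'p) poset_species_data \<Rightarrow> 'a hfin set set \<Rightarrow> ('a hfin set \<Rightarrow> 'p) set" where
  "prod_elems P \<pi> = (\<Pi>\<^sub>E T\<in>\<pi>. elems P T)"

definition prod_leq ::
  "('a, 'p) poset_species_data \<Rightarrow> 'a hfin set set \<Rightarrow> ('a hfin set \<Rightarrow> 'p) rel" where
  "prod_leq P \<pi> = {(u, v). u \<in> prod_elems P \<pi> \<and> v \<in> prod_elems P \<pi> \<and>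
                           (\<forall>T\<in>\<pi>. (u T, v T) \<in> leq P T)}"


section \<open>Operadic poset species\<close>

locale operadic_poset_species = poset_species P
  for P :: "('a, 'p) poset_species_data" +
  fixes a :: "'a hfin set \<Rightarrow> 'p \<Rightarrow> 'a hfin set set"
    and phi :: "'a hfin set \<Rightarrow> 'p \<Rightarrow> 'p \<Rightarrow> 'p"
    and psi :: "'a hfin set \<Rightarrow> 'p \<Rightarrow> 'p \<Rightarrow> ('a hfin set \<Rightarrow> 'p)"
  assumes a_hom: "poset_species_hom P Part a"
    and a_min: "fin_set S \<Longrightarrow> {x \<in> elems P S. a S x \<in> minimals Part S} = minimals P S"
    and a_max: "fin_set S \<Longrightarrow> {x \<in> elems P S. a S x \<in> maximals Part S} = maximals P S"
    and phi_hom: "\<lbrakk>fin_set S; x \<in> elems P S\<rbrakk> \<Longrightarrow>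
          poset_hom (lower P S x) (leq P S)
            (elems P (pts (a S x))) (leq P (pts (a S x))) (phi S x)"
    and psi_hom: "\<lbrakk>fin_set S; x \<in> elems P S\<rbrakk> \<Longrightarrow>
          poset_hom (upper P S x) (leq P S)
            (prod_elems P (a S x)) (prod_leq P (a S x)) (psi S x)"
    and a_phi: "\<lbrakk>fin_set S; x \<in> elems P S; y \<in> lower P S x\<rbrakk> \<Longrightarrow>
          a (pts (a S x)) (phi S x y) = part_phi (a S x) (a S y)"
    and a_psi: "\<lbrakk>fin_set S; x \<in> elems P S; y \<in> upper P S x\<rbrakk> \<Longrightarrow>
          (\<lambda>T\<in>a S x. a T (psi S x y T)) = part_psi (a S x) (a S y)"
    and equivariance_phi: "\<lbrakk>fin_set S; inj_on f S; x \<in> elems P S; y \<in> lower P S x\<rbrakk> \<Longrightarrow>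
          trans_map P (pts (a S x)) (blk_map f) (phi S x y) =
          phi (f ` S) (trans_map P S f x) (trans_map P S f y)"
    and equivariance_psi: "\<lbrakk>fin_set S; inj_on f S; x \<in> elems P S; y \<in> upper P S x; T \<in> a S x\<rbrakk> \<Longrightarrow>
          trans_map P T f (psi S x y T) =
          psi (f ` S) (trans_map P S f x) (trans_map P S f y) (f ` T)"
    and unitality: "\<exists>x. elems P {s} = {x}"
    and assoc_phi_phi:
      "\<lbrakk>fin_set S; x \<in> elems P S; x' \<in> elems P S; (x, x') \<in> leq P S; y \<in> lower P S x\<rbrakk> \<Longrightarrow>
          phi (pts (a S x')) (phi S x' x) (phi S x' y) =
          trans_map P (pts (a S x)) (ident (a S x')) (phi S x y)"
    and assoc_psi_psi:
      "\<lbrakk>fin_set S; x \<in> elems P S; x' \<in> elems P S; (x, x') \<in> leq P S; y \<in> upper P S x';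
        T \<in> a S x; B \<in> blocks_in (a S x') T\<rbrakk> \<Longrightarrow>
          psi T (psi S x x' T) (psi S x y T) B = psi S x' y B"
    and assoc_psi_phi:
      "\<lbrakk>fin_set S; x \<in> elems P S; x' \<in> elems P S; (x, x') \<in> leq P S;
        y \<in> upper P S x; y \<in> lower P S x'; T \<in> a S x\<rbrakk> \<Longrightarrow>
          psi (pts (a S x')) (phi S x' x) (phi S x' y) (pts (blocks_in (a S x') T)) =
          phi T (psi S x x' T) (psi S x y T)"


section \<open>Set operads\<close>

text \<open>\<open>compo Q \<pi> \<nu> \<xi>\<close> is \<open>\<nu> \<circ> (\<xi>\<^sub>T)\<close>, \<open>T \<in> \<pi>\<close>, for a partition \<open>\<pi>\<close> of \<open>S\<close>, \<open>\<nu> \<in> Q(\<pi>)\<close> and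
  \<open>\<xi>\<^sub>T \<in> Q(T)\<close>; the set \<open>S = \<Union>\<pi>\<close> is determined by \<open>\<pi>\<close>.\<close>

record ('a, 'q) set_operad_data =
  ops :: "'a hfin set \<Rightarrow> 'q set"
  act :: "'a hfin set \<Rightarrow> ('a hfin \<Rightarrow> 'a hfin) \<Rightarrow> 'q \<Rightarrow> 'q"
  compo :: "'a hfin set set \<Rightarrow> 'q \<Rightarrow> ('a hfin set \<Rightarrow> 'q) \<Rightarrow> 'q"
  unit_op :: "'a hfin \<Rightarrow> 'q"

definition decorations ::
  "('a, 'q) set_operad_data \<Rightarrow> 'a hfin set set \<Rightarrow> ('a hfin set \<Rightarrow> 'q) set" where
  "decorations Q \<pi> = (\<Pi>\<^sub>E T\<in>\<pi>. ops Q T)"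

text \<open>Transport of a decoration along a bijection \<open>f\<close>: the block \<open>T' = f ` T\<close> gets \<open>Q(f\<^sub>|\<^sub>T)(\<xi>\<^sub>T)\<close>.\<close>

definition push_dec :: "('a, 'q) set_operad_data \<Rightarrow> ('a hfin \<Rightarrow> 'a hfin) \<Rightarrow>
    'a hfin set set \<Rightarrow> ('a hfin set \<Rightarrow> 'q) \<Rightarrow> ('a hfin set \<Rightarrow> 'q)" where
  "push_dec Q f \<pi> \<xi> = (\<lambda>T'\<in>(`) f ` \<pi>. let T = f -` T' \<inter> \<Union>\<pi> in act Q T f (\<xi> T))"

text \<open>Compositions are indexed by partitions, so all blocks are non-empty; this describes set
  operads without operations of arity zero.  In \<open>compo_assoc\<close>, \<open>\<alpha> \<le> \<beta>\<close>, and \<open>\<zeta>\<close> is a family indexed by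
  the blocks \<open>\<beta>\<^sub>|\<^sub>A\<close> of the partition \<open>{\<beta>\<^sub>|\<^sub>A. A \<in> \<alpha>}\<close> of \<open>\<beta>\<close>:
  \<open>\<mu> \<circ> (\<zeta>\<^sub>A \<circ> (\<xi>\<^sub>B)) = (\<mu> \<circ> (\<zeta>\<^sub>A)) \<circ> (\<xi>\<^sub>B)\<close>.\<close>

locale set_operad =
  fixes Q :: "('a, 'q) set_operad_data"
  assumes act_closed: "\<lbrakk>fin_set S; inj_on f S; q \<in> ops Q S\<rbrakk> \<Longrightarrow> act Q S f q \<in> ops Q (f ` S)"
    and act_cong: "\<lbrakk>fin_set S; inj_on f S; \<And>s. s \<in> S \<Longrightarrow> f s = g s; q \<in> ops Q S\<rbrakk> \<Longrightarrow>
          act Q S f q = act Q S g q"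
    and act_id: "\<lbrakk>fin_set S; q \<in> ops Q S\<rbrakk> \<Longrightarrow> act Q S id q = q"
    and act_comp: "\<lbrakk>fin_set S; inj_on f S; inj_on g (f ` S); q \<in> ops Q S\<rbrakk> \<Longrightarrow>
          act Q S (g \<circ> f) q = act Q (f ` S) g (act Q S f q)"
    and compo_closed:
      "\<lbrakk>fin_set S; partition_on S \<pi>; \<nu> \<in> ops Q (pts \<pi>); \<xi> \<in> decorations Q \<pi>\<rbrakk> \<Longrightarrow>
          compo Q \<pi> \<nu> \<xi> \<in> ops Q S"
    and compo_equivariant:
      "\<lbrakk>fin_set S; partition_on S \<pi>; \<nu> \<in> ops Q (pts \<pi>); \<xi> \<in> decorations Q \<pi>; inj_on f S\<rbrakk> \<Longrightarrow>
          act Q S f (compo Q \<pi> \<nu> \<xi>) =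
          compo Q ((`) f ` \<pi>) (act Q (pts \<pi>) (blk_map f) \<nu>) (push_dec Q f \<pi> \<xi>)"
    and unit_closed: "unit_op Q s \<in> ops Q {s}"
    and unit_natural: "act Q {s} f (unit_op Q s) = unit_op Q (f s)"
    and unit_left: "\<lbrakk>fin_set S; q \<in> ops Q S\<rbrakk> \<Longrightarrow>
          compo Q {S} (unit_op Q (blk S)) (\<lambda>T\<in>{S}. q) = q"
    and unit_right: "\<lbrakk>fin_set S; q \<in> ops Q S\<rbrakk> \<Longrightarrow>
          compo Q (singletons S) (act Q S (\<lambda>s. blk {s}) q)
            (\<lambda>T\<in>singletons S. unit_op Q (the_elem T)) = q"
    and compo_assoc:
      "\<lbrakk>fin_set S; refines S \<beta> \<alpha>; \<mu> \<in> ops Q (pts \<alpha>);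
        \<zeta> \<in> decorations Q (part_phi \<beta> \<alpha>); \<xi> \<in> decorations Q \<beta>\<rbrakk> \<Longrightarrow>
          compo Q \<alpha> \<mu> (\<lambda>A\<in>\<alpha>. compo Q (blocks_in \<beta> A) (\<zeta> (pts (blocks_in \<beta> A)))
                                (restrict \<xi> (blocks_in \<beta> A))) =
          compo Q \<beta> (compo Q (part_phi \<beta> \<alpha>) (act Q (pts \<alpha>) (ident \<beta>) \<mu>) \<zeta>) \<xi>"


section \<open>Right-decorated partitions\<close>

type_synonym ('a, 'q) dec_partition = "'a hfin set set \<times> ('a hfin set \<Rightarrow> 'q)"

definition dec_partitions ::
  "('a, 'q) set_operad_data \<Rightarrow> 'a hfin set \<Rightarrow> ('a, 'q) dec_partition set" where
  "dec_partitions Q S = {(\<pi>, \<xi>). partition_on S \<pi> \<and> \<xi> \<in> decorations Q \<pi>}"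

definition dec_leq :: "('a, 'q) set_operad_data \<Rightarrow> 'a hfin set \<Rightarrow> ('a, 'q) dec_partition rel" where
  "dec_leq Q S = {((\<alpha>, \<eta>), (\<beta>, \<xi>)).
     (\<alpha>, \<eta>) \<in> dec_partitions Q S \<and> (\<beta>, \<xi>) \<in> dec_partitions Q S \<and> (\<alpha>, \<beta>) \<in> leq Part S \<and>
     (\<forall>A\<in>\<alpha>. \<exists>\<nu>\<in>ops Q (pts (blocks_in \<beta> A)).
        \<eta> A = compo Q (blocks_in \<beta> A) \<nu> (restrict \<xi> (blocks_in \<beta> A)))}"

definition Dec_Part :: "('a, 'q) set_operad_data \<Rightarrow> ('a, ('a, 'q) dec_partition) poset_species_data"
where
  "Dec_Part Q = \<lparr> elems = dec_partitions Q,
                  leq = dec_leq Q,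
                  trans_map = (\<lambda>S f (\<pi>, \<xi>). ((`) f ` \<pi>, push_dec Q f \<pi> \<xi>)) \<rparr>"

definition right_basic :: "('a, 'q) set_operad_data \<Rightarrow> bool" where
  "right_basic Q \<longleftrightarrow>
     (\<forall>S. fin_set S \<longrightarrow> (\<forall>(\<pi>, \<xi>)\<in>dec_partitions Q S. inj_on (\<lambda>\<nu>. compo Q \<pi> \<nu> \<xi>) (ops Q (pts \<pi>))))"

definition dec_forget :: "'a hfin set \<Rightarrow> ('a, 'q) dec_partition \<Rightarrow> 'a hfin set set" where
  "dec_forget S = fst"

text \<open>The description is definite only for \<open>(\<alpha>, \<eta>) \<le> (\<pi>, \<xi>)\<close> and right-basic \<open>Q\<close>.\<close>

definition dec_phi :: "('a, 'q) set_operad_data \<Rightarrow> 'a hfin set \<Rightarrow>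
    ('a, 'q) dec_partition \<Rightarrow> ('a, 'q) dec_partition \<Rightarrow> ('a, 'q) dec_partition" where
  "dec_phi Q S = (\<lambda>(\<pi>, \<xi>) (\<alpha>, \<eta>).
     (part_phi \<pi> \<alpha>,
      \<lambda>C\<in>part_phi \<pi> \<alpha>. THE \<nu>. \<exists>A\<in>\<alpha>. C = pts (blocks_in \<pi> A) \<and> \<nu> \<in> ops Q C \<and>
         \<eta> A = compo Q (blocks_in \<pi> A) \<nu> (restrict \<xi> (blocks_in \<pi> A))))"

definition dec_psi :: "'a hfin set \<Rightarrow>
    ('a, 'q) dec_partition \<Rightarrow> ('a, 'q) dec_partition \<Rightarrow> 'a hfin set \<Rightarrow> ('a, 'q) dec_partition" where
  "dec_psi S = (\<lambda>(\<pi>, \<xi>) (\<beta>, \<nu>). \<lambda>T\<in>\<pi>. (blocks_in \<beta> T, restrict \<nu> (blocks_in \<beta> T)))"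

end

(* The morphism phi divides a decoration from the right by the decoration of the larger partition;
   right-basicness makes the quotient unique, so every identity for phi amounts to exhibiting the
   expected quotient. Associativity of the operad composes two such quotients, which yields
   transitivity of the order, monotonicity of phi and phi-phi associativity at once; equivariance of
   the composition handles transport. The morphism psi merely restricts decorations. The least
   elements exist because Q is non-empty in each arity, and the greatest ones are decorated by units;
   the axiom on units on the right shows that they dominate everything. *)

theory Submission
  imports Defs
begin

section \<open>Points, blocks and refinements\<close>

text \<open>The obstacle is bookkeeping between different copies of one finite set. For \<alpha>
  \<le> \<beta>, the quotient attached to a block C of a still coarser partition is an operation on
  the points \<open>blk A\<close>, whereas after \<phi> it has to live on the points
  \<open>blk (pts (blocks_in \<beta> A))\<close>. The map \<open>ident \<beta>\<close> mediates, and
  it must be compared with its local version \<open>ident (blocks_in \<beta> C)\<close>, because the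
  associativity axiom concerns a partition of a whole set and is used on the single block C. Hence
  the lemmas on how \<open>blocks_in\<close>, \<open>pts\<close>, \<open>part_phi\<close> and
  \<open>ident\<close> commute.

  Quotients are handled through the relation \<open>is_factor\<close> instead of the definite
  description in \<open>dec_phi\<close>. Their existence is what the order records, and composing or
  transporting them is possible in every set operad; right-basicness enters only through
  \<open>is_factor_unique\<close>. Antisymmetry has another source: over an unchanged partition the
  quotient is an operation on one point, hence the unit.\<close>

lemma fset_Abs_fset: "finite T \<Longrightarrow> fset (Abs_fset T) = T"
  by (simp add: Abs_fset_inverse)

text \<open>\<open>Abs_fset\<close> is specified on finite sets only, so finiteness of blocks is
  carried along wherever points are decoded.\<close>

lemma blk_eq_iff: "finite A \<Longrightarrow> finite B \<Longrightarrow> blk A = blk B \<longleftrightarrow> A = B"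
  unfolding blk_def by (metis fset_Abs_fset hfin.inject(2))

lemma blk_map_blk: "finite T \<Longrightarrow> blk_map f (blk T) = blk (f ` T)"
  by (simp add: blk_map_def blk_def fset_Abs_fset)

lemma ident_blk: "finite A \<Longrightarrow> ident \<pi> (blk A) = blk (pts (blocks_in \<pi> A))"
  by (simp add: ident_def blk_def fset_Abs_fset)

lemma finite_block: "finite S \<Longrightarrow> partition_on S \<pi> \<Longrightarrow> A \<in> \<pi> \<Longrightarrow> finite A"
  by (metis Sup_upper finite_subset partition_onD1)

lemma fin_set_block: "fin_set S \<Longrightarrow> partition_on S \<pi> \<Longrightarrow> A \<in> \<pi> \<Longrightarrow> fin_set A"
  unfolding fin_set_def by (metis finite_block partition_onD3)

lemma inj_on_blk: "finite S \<Longrightarrow> partition_on S \<pi> \<Longrightarrow> inj_on blk \<pi>"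
  by (auto simp: inj_on_def blk_eq_iff finite_block)

lemma fin_set_pts: "fin_set S \<Longrightarrow> partition_on S \<pi> \<Longrightarrow> fin_set (pts \<pi>)"
  unfolding fin_set_def pts_def
  by (metis Union_empty finite_elements finite_imageI image_is_empty partition_onD1)

lemma pts_singleton: "pts {A} = {blk A}"
  by (simp add: pts_def)

lemma finite_pts_blocks_in: "finite S \<Longrightarrow> partition_on S \<pi> \<Longrightarrow> finite (pts (blocks_in \<pi> A))"
  using finite_elements[of S \<pi>] by (simp add: pts_def blocks_in_def)

lemma refinesD: "refines S \<beta> \<alpha> \<Longrightarrow> partition_on S \<beta>" "refines S \<beta> \<alpha> \<Longrightarrow> partition_on S \<alpha>"
  by (auto simp: refines_def)

lemma partition_blocks_in: "refines S \<beta> \<alpha> \<Longrightarrow> A \<in> \<alpha> \<Longrightarrow> partition_on A (blocks_in \<beta> A)"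
  unfolding blocks_in_def by (rule refines_obtains_subset)

lemma Union_blocks_in: "refines S \<beta> \<alpha> \<Longrightarrow> A \<in> \<alpha> \<Longrightarrow> \<Union>(blocks_in \<beta> A) = A"
  using partition_blocks_in partition_onD1 by metis

lemma blocks_in_nonempty: "refines S \<beta> \<alpha> \<Longrightarrow> A \<in> \<alpha> \<Longrightarrow> blocks_in \<beta> A \<noteq> {}"
  by (metis Union_blocks_in Union_empty partition_onD3 refinesD(2))

lemma blocks_in_blocks_in: "A \<subseteq> T \<Longrightarrow> blocks_in (blocks_in \<beta> T) A = blocks_in \<beta> A"
  by (auto simp: blocks_in_def)

lemma blocks_in_self: "partition_on S \<pi> \<Longrightarrow> A \<in> \<pi> \<Longrightarrow> blocks_in \<pi> A = {A}"
  unfolding blocks_in_def partition_on_def disjoint_def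
  by (auto; metis inf.absorb1 inf.absorb_iff1)

lemma blocks_in_whole: "partition_on S \<pi> \<Longrightarrow> blocks_in \<pi> S = \<pi>"
  unfolding blocks_in_def using partition_onD1[of S \<pi>] by auto

lemma blocks_in_singletons: "A \<subseteq> S \<Longrightarrow> blocks_in (singletons S) A = singletons A"
  by (auto simp: blocks_in_def singletons_def)

lemma refines_blocks_in:
  assumes "refines S \<beta> \<alpha>" "refines S \<alpha> \<gamma>" "C \<in> \<gamma>"
  shows "refines C (blocks_in \<beta> C) (blocks_in \<alpha> C)"
  unfolding refines_def
proof (intro conjI ballI)
  show "partition_on C (blocks_in \<beta> C)" "partition_on C (blocks_in \<alpha> C)"
    using assms partition_blocks_in refines_trans by blast+
  fix B assume B: "B \<in> blocks_in \<beta> C"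
  then obtain A where A: "A \<in> \<alpha>" "B \<subseteq> A" "B \<noteq> {}"
    using assms(1) unfolding refines_def blocks_in_def partition_on_def by blast
  then obtain C' where C': "C' \<in> \<gamma>" "A \<subseteq> C'" using assms(2) unfolding refines_def by blast
  \<comment> \<open>The non-empty B lies in C and, through A, in C', and two blocks of \<gamma> that
    meet coincide.\<close>
  have "C' = C" using assms(2,3) A B C' unfolding refines_def partition_on_def disjoint_def blocks_in_def
    by (metis (lifting) Int_greatest mem_Collect_eq subset_empty subset_trans)
  then show "\<exists>A\<in>blocks_in \<alpha> C. B \<subseteq> A" using A C' unfolding blocks_in_def by blast
qed

lemma inj_on_image_subset_iff:
  "inj_on f S \<Longrightarrow> A \<subseteq> S \<Longrightarrow> B \<subseteq> S \<Longrightarrow> f ` A \<subseteq> f ` B \<longleftrightarrow> A \<subseteq> B"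
  by (auto simp: inj_on_def) blast

lemma pts_subset_iff:
  "finite S \<Longrightarrow> partition_on S \<pi> \<Longrightarrow> \<rho> \<subseteq> \<pi> \<Longrightarrow> \<sigma> \<subseteq> \<pi> \<Longrightarrow> pts \<rho> \<subseteq> pts \<sigma> \<longleftrightarrow> \<rho> \<subseteq> \<sigma>"
  unfolding pts_def by (meson inj_on_blk inj_on_image_subset_iff)

text \<open>A block of a coarsening is the union of the blocks of \<beta> inside it, so nothing is
  lost by passing to points. Two coarsenings are allowed because both uses occur: \<alpha> =
  \<gamma> gives injectivity of \<open>A \<mapsto> pts (blocks_in \<beta> A)\<close>, and different
  ones compare nested blocks.\<close>

lemma pts_blocks_in_subset_iff:
  assumes "finite S" "refines S \<beta> \<alpha>" "A \<in> \<alpha>" "refines S \<beta> \<gamma>" "C \<in> \<gamma>"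
  shows "pts (blocks_in \<beta> A) \<subseteq> pts (blocks_in \<beta> C) \<longleftrightarrow> A \<subseteq> C"
proof -
  have "pts (blocks_in \<beta> A) \<subseteq> pts (blocks_in \<beta> C) \<longleftrightarrow> blocks_in \<beta> A \<subseteq> blocks_in \<beta> C"
    using pts_subset_iff[of S \<beta>] assms refinesD by (metis (lifting) blocks_in_def mem_Collect_eq subsetI)
  also have "\<dots> \<longleftrightarrow> A \<subseteq> C"
  proof
    assume "blocks_in \<beta> A \<subseteq> blocks_in \<beta> C"
    then have "\<Union>(blocks_in \<beta> A) \<subseteq> \<Union>(blocks_in \<beta> C)" by blast
    then show "A \<subseteq> C" using Union_blocks_in assms by metis
  qed (auto simp: blocks_in_def)
  finally show ?thesis .
qed

lemma inj_on_pts_blocks_in: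
  assumes "finite S" "refines S \<beta> \<alpha>"
  shows "inj_on (\<lambda>A. pts (blocks_in \<beta> A)) \<alpha>"
  using pts_blocks_in_subset_iff[OF assms(1,2) _ assms(2)] by (auto simp: inj_on_def)

lemma ident_image_pts:
  assumes "\<And>A. A \<in> \<alpha> \<Longrightarrow> finite A"
  shows "ident \<beta> ` pts \<alpha> = pts (part_phi \<beta> \<alpha>)"
  using assms unfolding pts_def part_phi_def image_image by (simp add: ident_blk pts_def cong: image_cong)

lemma inj_on_ident:
  assumes "finite S" "refines S \<beta> \<alpha>"
  shows "inj_on (ident \<beta>) (pts \<alpha>)"
proof -
  have id: "ident \<beta> (blk A) = blk (pts (blocks_in \<beta> A))" if "A \<in> \<alpha>" for A
    using that assms by (meson finite_block ident_blk refinesD(2))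
  have "A = A'" if "A \<in> \<alpha>" "A' \<in> \<alpha>" "blk (pts (blocks_in \<beta> A)) = blk (pts (blocks_in \<beta> A'))" for A A'
    using that inj_on_pts_blocks_in[OF assms] finite_pts_blocks_in[of S \<beta>] assms refinesD(1)
    by (metis (no_types, lifting) blk_eq_iff inj_onD)
  then show ?thesis by (auto simp: inj_on_def pts_def id)
qed

lemma blocks_in_part_phi:
  assumes "finite S" "refines S \<beta> \<alpha>" "refines S \<beta> \<gamma>" "C \<in> \<gamma>"
  shows "blocks_in (part_phi \<beta> \<alpha>) (pts (blocks_in \<beta> C)) = part_phi \<beta> (blocks_in \<alpha> C)"
proof -
  have "blocks_in (part_phi \<beta> \<alpha>) (pts (blocks_in \<beta> C)) =
    {X \<in> part_phi \<beta> \<alpha>. X \<subseteq> pts (blocks_in \<beta> C)}"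
    by (simp add: blocks_in_def)
  also have "\<dots> = part_phi \<beta> {A \<in> \<alpha>. A \<subseteq> C}"
    using pts_blocks_in_subset_iff[OF assms(1,2) _ assms(3,4)] unfolding part_phi_def by auto
  finally show ?thesis by (simp add: blocks_in_def)
qed

text \<open>Each A that occurs lies in C, so it sees the same blocks of \<beta> before and after the
  cut. With \<open>blocks_in_part_phi\<close> this is the exchange law between \<phi> and \<psi> for
  undecorated partitions.\<close>

lemma part_phi_blocks_in: "part_phi (blocks_in \<beta> C) (blocks_in \<alpha> C) = part_phi \<beta> (blocks_in \<alpha> C)"
  unfolding part_phi_def
  by (rule image_cong) (simp_all add: blocks_in_blocks_in blocks_in_def[of \<alpha>])

lemma partition_part_phi:
  assumes "finite S" "refines S \<beta> \<alpha>"
  shows "partition_on (pts \<beta>) (part_phi \<beta> \<alpha>)"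
proof (rule partition_onI)
  have "B \<in> \<Union>(blocks_in \<beta> ` \<alpha>)" if "B \<in> \<beta>" for B
    using that assms(2) unfolding refines_def blocks_in_def by auto
  then have "\<Union>(blocks_in \<beta> ` \<alpha>) = \<beta>" by (auto simp: blocks_in_def)
  then show "\<Union>(part_phi \<beta> \<alpha>) = pts \<beta>" unfolding part_phi_def pts_def by blast
  show "{} \<notin> part_phi \<beta> \<alpha>"
    using blocks_in_nonempty[OF assms(2)] by (auto simp: part_phi_def pts_def)
  fix p q assume "p \<in> part_phi \<beta> \<alpha>" "q \<in> part_phi \<beta> \<alpha>" "p \<noteq> q"
  then obtain A A' where A: "A \<in> \<alpha>" "A' \<in> \<alpha>" "A \<noteq> A'"
    and pq: "p = blk ` blocks_in \<beta> A" "q = blk ` blocks_in \<beta> A'"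
    by (auto simp: part_phi_def pts_def)
  have "A \<inter> A' = {}" using A assms(2) unfolding refines_def partition_on_def disjoint_def by blast
  \<comment> \<open>A block of \<beta> inside both A and A' would be empty. Injectivity of
    \<open>blk\<close> on \<beta> then carries disjointness over to the points.\<close>
  then have "blocks_in \<beta> A \<inter> blocks_in \<beta> A' = {}"
    using refinesD(1)[OF assms(2)] unfolding blocks_in_def partition_on_def
    by (auto; metis Int_greatest subset_empty)
  then show "disjnt p q"
    using inj_on_image_Int[OF inj_on_blk[OF assms(1) refinesD(1)[OF assms(2)]], of "blocks_in \<beta> A" "blocks_in \<beta> A'"]
    unfolding pq disjnt_def by (auto simp: blocks_in_def)
qed

lemma pts_part_phi_blocks_in:
  assumes "finite S" "refines S \<beta> \<alpha>" "refines S \<alpha> \<gamma>" "C \<in> \<gamma>"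
  shows "pts (blocks_in (part_phi \<beta> \<alpha>) (pts (blocks_in \<beta> C))) = ident \<beta> ` pts (blocks_in \<alpha> C)"
proof -
  have "finite A" if "A \<in> blocks_in \<alpha> C" for A
    using that assms finite_block refinesD(1) by (metis (lifting) blocks_in_def mem_Collect_eq)
  then show ?thesis
    using assms blocks_in_part_phi[OF assms(1,2) refines_trans[OF assms(2,3)] assms(4)]
    by (simp add: ident_image_pts)
qed

text \<open>This is associativity of \<phi> without decorations. The left side partitions the points
  of \<open>part_phi \<beta> \<alpha>\<close>, whereas \<open>part_phi \<alpha> \<gamma>\<close>
  partitions those of \<alpha>; \<open>ident \<beta>\<close> is the relabelling that makes the two
  comparable.\<close>

lemma part_phi_part_phi:
  assumes "finite S" "refines S \<beta> \<alpha>" "refines S \<alpha> \<gamma>"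
  shows "part_phi (part_phi \<beta> \<alpha>) (part_phi \<beta> \<gamma>) = (`) (ident \<beta>) ` part_phi \<alpha> \<gamma>"
proof -
  have "part_phi (part_phi \<beta> \<alpha>) (part_phi \<beta> \<gamma>) =
      (\<lambda>C. pts (blocks_in (part_phi \<beta> \<alpha>) (pts (blocks_in \<beta> C)))) ` \<gamma>"
    by (simp add: part_phi_def[of "part_phi \<beta> \<alpha>"] part_phi_def[of \<beta> \<gamma>] image_image)
  also have "\<dots> = (\<lambda>C. ident \<beta> ` pts (blocks_in \<alpha> C)) ` \<gamma>"
    using pts_part_phi_blocks_in[OF assms] by (rule image_cong[OF refl])
  finally show ?thesis by (simp add: part_phi_def[of \<alpha>] image_image)
qed

lemma refines_part_phi:
  assumes "finite S" "refines S \<beta> \<alpha>" "refines S \<alpha> \<gamma>"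
  shows "refines (pts \<beta>) (part_phi \<beta> \<alpha>) (part_phi \<beta> \<gamma>)"
proof -
  have "refines S \<beta> \<gamma>" using assms refines_trans by blast
  moreover have "\<exists>Y\<in>part_phi \<beta> \<gamma>. X \<subseteq> Y" if X: "X \<in> part_phi \<beta> \<alpha>" for X
  proof -
    obtain A where A: "A \<in> \<alpha>" "X = pts (blocks_in \<beta> A)" using X by (auto simp: part_phi_def)
    then obtain C where "C \<in> \<gamma>" "A \<subseteq> C" using assms(3) unfolding refines_def by blast
    then show ?thesis
      using A pts_blocks_in_subset_iff[OF assms(1,2) _ \<open>refines S \<beta> \<gamma>\<close>] by (auto simp: part_phi_def)
  qed
  ultimately show ?thesis unfolding refines_def[of "pts \<beta>"]
    using partition_part_phi assms by blast
qed

section \<open>Transport of partitions\<close>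

lemma partition_image:
  assumes "partition_on S \<pi>" "inj_on f S"
  shows "partition_on (f ` S) ((`) f ` \<pi>)"
proof -
  \<comment> \<open>The library lemma on injective images discards the empty set; images of blocks
    are non-empty, so it discards nothing.\<close>
  have "(`) f ` \<pi> - {{}} = (`) f ` \<pi>" using partition_onD3[OF assms(1)] by auto
  then show ?thesis using partition_on_inj_image[OF assms] by simp
qed

lemma refines_image: "refines S \<beta> \<alpha> \<Longrightarrow> inj_on f S \<Longrightarrow> refines (f ` S) ((`) f ` \<beta>) ((`) f ` \<alpha>)"
  unfolding refines_def by (auto simp: partition_image) (meson image_mono)

lemma blocks_in_image:
  assumes "partition_on S \<beta>" "inj_on f S" "A \<subseteq> S"
  shows "blocks_in ((`) f ` \<beta>) (f ` A) = (`) f ` blocks_in \<beta> A"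
proof -
  have "f ` B \<subseteq> f ` A \<longleftrightarrow> B \<subseteq> A" if "B \<in> \<beta>" for B
    using that assms by (metis Sup_upper inj_on_image_subset_iff partition_onD1)
  then show ?thesis unfolding blocks_in_def by auto
qed

lemma blk_map_image_pts:
  assumes "\<And>B. B \<in> \<pi> \<Longrightarrow> finite B"
  shows "blk_map f ` pts \<pi> = pts ((`) f ` \<pi>)"
  using assms by (simp add: pts_def image_image blk_map_blk)

lemma blk_map_image_pts_blocks_in:
  assumes "finite S" "partition_on S \<beta>" "inj_on f S" "A \<subseteq> S"
  shows "blk_map f ` pts (blocks_in \<beta> A) = pts (blocks_in ((`) f ` \<beta>) (f ` A))"
  using assms by (subst blk_map_image_pts) (auto simp: blocks_in_image finite_block blocks_in_def[of \<beta>])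

lemma inj_on_blk_map:
  assumes "finite S" "partition_on S \<pi>" "inj_on f S"
  shows "inj_on (blk_map f) (pts \<pi>)"
proof -
  have "B = B'" if "B \<in> \<pi>" "B' \<in> \<pi>" "blk (f ` B) = blk (f ` B')" for B B'
  proof -
    have "f ` B = f ` B'" using that assms finite_block by (metis blk_eq_iff finite_imageI)
    then show ?thesis using that assms
      by (metis Sup_upper inj_on_image_eq_iff partition_onD1)
  qed
  then show ?thesis using assms by (auto simp: inj_on_def pts_def blk_map_blk finite_block)
qed

lemma part_phi_image:
  assumes "finite S" "refines S \<beta> \<alpha>" "inj_on f S"
  shows "part_phi ((`) f ` \<beta>) ((`) f ` \<alpha>) = (`) (blk_map f) ` part_phi \<beta> \<alpha>"
proof -
  have "A \<subseteq> S" if "A \<in> \<alpha>" for A using that assms(2) by (metis Sup_upper partition_onD1 refinesD(2))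
  then show ?thesis unfolding part_phi_def image_image
    using blk_map_image_pts_blocks_in[OF assms(1) refinesD(1)[OF assms(2)] assms(3)] by simp
qed

section \<open>Transport of decorations\<close>

lemma decorations_restrict: "\<xi> \<in> decorations Q \<pi> \<Longrightarrow> \<sigma> \<subseteq> \<pi> \<Longrightarrow> restrict \<xi> \<sigma> \<in> decorations Q \<sigma>"
  unfolding decorations_def by auto

lemma decorationsD: "\<xi> \<in> decorations Q \<pi> \<Longrightarrow> A \<in> \<pi> \<Longrightarrow> \<xi> A \<in> ops Q A"
  unfolding decorations_def by auto

lemma decorations_eqI:
  "\<xi> \<in> decorations Q \<pi> \<Longrightarrow> \<eta> \<in> decorations Q \<pi> \<Longrightarrow> (\<And>A. A \<in> \<pi> \<Longrightarrow> \<xi> A = \<eta> A) \<Longrightarrow> \<xi> = \<eta>"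
  unfolding decorations_def by (rule PiE_ext)

lemma blocks_in_subset: "blocks_in \<pi> A \<subseteq> \<pi>"
  by (auto simp: blocks_in_def)

text \<open>\<open>push_dec\<close> recovers the source block as a preimage inside the union of its
  family; injectivity on S makes this preimage T. The subfamily \<sigma> matters because restricting
  a decoration also shrinks that union.\<close>

lemma push_dec_apply:
  assumes "partition_on S \<pi>" "inj_on f S" "\<sigma> \<subseteq> \<pi>" "T \<in> \<sigma>"
  shows "push_dec Q f \<sigma> \<xi> (f ` T) = act Q T f (\<xi> T)"
proof -
  have "f -` (f ` T) \<inter> \<Union>\<sigma> = T"
    using assms partition_onD1[OF assms(1)] unfolding inj_on_def by blast
  then show ?thesis using assms(4) by (simp add: push_dec_def)
qed

lemma push_dec_restrict:
  assumes "partition_on S \<pi>" "inj_on f S" "\<sigma> \<subseteq> \<pi>"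
  shows "push_dec Q f \<sigma> (restrict \<xi> \<sigma>) = restrict (push_dec Q f \<pi> \<xi>) ((`) f ` \<sigma>)"
proof (rule extensionalityI[of _ "(`) f ` \<sigma>"])
  fix T' assume "T' \<in> (`) f ` \<sigma>"
  then obtain T where "T \<in> \<sigma>" "T' = f ` T" by blast
  then show "push_dec Q f \<sigma> (restrict \<xi> \<sigma>) T' = restrict (push_dec Q f \<pi> \<xi>) ((`) f ` \<sigma>) T'"
    using assms(3) by (simp add: push_dec_apply[OF assms] push_dec_apply[OF assms(1,2) order_refl] subset_iff)
qed (auto simp: push_dec_def)

section \<open>Factorizations of operations\<close>

text \<open>A right quotient of q by the decorations of the blocks inside A. Being a relation, it
  separates existence, which defines the order, from uniqueness, which makes \<phi> well
  defined.\<close>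

definition is_factor ::
  "('a, 'q) set_operad_data \<Rightarrow> 'a hfin set set \<Rightarrow> ('a hfin set \<Rightarrow> 'q) \<Rightarrow> 'a hfin set \<Rightarrow> 'q \<Rightarrow> 'q \<Rightarrow> bool" where
  "is_factor Q \<pi> \<xi> A q \<nu> \<longleftrightarrow> \<nu> \<in> ops Q (pts (blocks_in \<pi> A)) \<and>
     q = compo Q (blocks_in \<pi> A) \<nu> (restrict \<xi> (blocks_in \<pi> A))"

text \<open>Factors over A depend only on the blocks inside A. All compatibilities of \<psi> with
  the order and with \<phi> rest on this; the equality of predicates lets it serve as a rewrite
  rule.\<close>

lemma is_factor_restrict:
  "A \<subseteq> T \<Longrightarrow> is_factor Q (blocks_in \<pi> T) (restrict \<xi> (blocks_in \<pi> T)) A = is_factor Q \<pi> \<xi> A"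
proof -
  assume "A \<subseteq> T"
  moreover from this have "blocks_in \<pi> T \<inter> blocks_in \<pi> A = blocks_in \<pi> A" by (auto simp: blocks_in_def)
  ultimately show ?thesis unfolding is_factor_def fun_eq_iff by (simp add: blocks_in_blocks_in)
qed

lemma dec_partitions_iff: "(\<pi>, \<xi>) \<in> dec_partitions Q S \<longleftrightarrow> partition_on S \<pi> \<and> \<xi> \<in> decorations Q \<pi>"
  by (simp add: dec_partitions_def)

lemma dec_leq_iff:
  "((\<alpha>, \<eta>), (\<beta>, \<xi>)) \<in> dec_leq Q S \<longleftrightarrow> refines S \<beta> \<alpha> \<and> \<eta> \<in> decorations Q \<alpha> \<and> \<xi> \<in> decorations Q \<beta> \<and>
     (\<forall>A\<in>\<alpha>. \<exists>\<nu>. is_factor Q \<beta> \<xi> A (\<eta> A) \<nu>)"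
  unfolding dec_leq_def dec_partitions_def Part_def is_factor_def refines_def by auto

lemma dec_leqD: "(x, y) \<in> dec_leq Q S \<Longrightarrow> x \<in> dec_partitions Q S" "(x, y) \<in> dec_leq Q S \<Longrightarrow> y \<in> dec_partitions Q S"
  unfolding dec_leq_def by auto

context set_operad
begin

lemma push_dec_closed:
  assumes "fin_set S" "partition_on S \<pi>" "inj_on f S" "\<xi> \<in> decorations Q \<pi>"
  shows "push_dec Q f \<pi> \<xi> \<in> decorations Q ((`) f ` \<pi>)"
proof -
  have "push_dec Q f \<pi> \<xi> (f ` T) \<in> ops Q (f ` T)" if "T \<in> \<pi>" for T
    using push_dec_apply[OF assms(2,3) order_refl that]
      act_closed[OF fin_set_block[OF assms(1,2) that] _ decorationsD[OF assms(4) that]]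
      assms(2,3) that by (metis Sup_upper inj_on_subset partition_onD1)
  then show ?thesis by (auto simp: decorations_def push_dec_def)
qed

text \<open>The only block of \<pi> inside A is A itself, so this is the left unit axiom.\<close>

lemma is_factor_self:
  assumes "fin_set S" "partition_on S \<pi>" "\<xi> \<in> decorations Q \<pi>" "A \<in> \<pi>"
  shows "is_factor Q \<pi> \<xi> A (\<xi> A) (unit_op Q (blk A))"
proof -
  have "compo Q {A} (unit_op Q (blk A)) (\<lambda>T\<in>{A}. \<xi> A) = \<xi> A"
    using assms unit_left fin_set_block decorationsD by metis
  moreover have "(\<lambda>T\<in>{A}. \<xi> A) = restrict \<xi> {A}" by (auto simp: restrict_def)
  ultimately show ?thesis
    using assms unit_closed by (simp add: is_factor_def blocks_in_self pts_singleton)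
qed

text \<open>Equivariance of the composition is applied on the finite set A. The quotient is an
  operation on blocks, so it moves along \<open>blk_map f\<close> while q moves along f.\<close>

lemma is_factor_push:
  assumes "fin_set S" "refines S \<beta> \<alpha>" "A \<in> \<alpha>" "inj_on f S" "\<xi> \<in> decorations Q \<beta>"
    and "is_factor Q \<beta> \<xi> A q \<nu>"
  shows "is_factor Q ((`) f ` \<beta>) (push_dec Q f \<beta> \<xi>) (f ` A) (act Q A f q)
           (act Q (pts (blocks_in \<beta> A)) (blk_map f) \<nu>)"
proof -
  note p = refinesD[OF assms(2)]
  have S: "finite S" and A: "fin_set A" and AS: "A \<subseteq> S"
    using assms(1,3) fin_set_block[OF assms(1) p(2)] partition_onD1[OF p(2)]
    by (auto simp: fin_set_def)
  have fA: "inj_on f A" using assms(4) AS inj_on_subset by blast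
  have pA: "partition_on A (blocks_in \<beta> A)" using assms partition_blocks_in by blast
  have "act Q (pts (blocks_in \<beta> A)) (blk_map f) \<nu> \<in> ops Q (blk_map f ` pts (blocks_in \<beta> A))"
    using A pA fA assms(6) unfolding is_factor_def
    by (meson act_closed fin_set_def fin_set_pts inj_on_blk_map)
  moreover have "blk_map f ` pts (blocks_in \<beta> A) = pts (blocks_in ((`) f ` \<beta>) (f ` A))"
    using S p assms AS blk_map_image_pts_blocks_in by blast
  moreover have "act Q A f q = compo Q ((`) f ` blocks_in \<beta> A) (act Q (pts (blocks_in \<beta> A)) (blk_map f) \<nu>)
      (push_dec Q f (blocks_in \<beta> A) (restrict \<xi> (blocks_in \<beta> A)))"
    using assms(6) compo_equivariant[OF A pA _ decorations_restrict[OF assms(5) blocks_in_subset] fA]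
    by (simp add: is_factor_def)
  moreover have "push_dec Q f (blocks_in \<beta> A) (restrict \<xi> (blocks_in \<beta> A)) =
      restrict (push_dec Q f \<beta> \<xi>) ((`) f ` blocks_in \<beta> A)"
    using p(1) assms(4) blocks_in_subset by (rule push_dec_restrict)
  ultimately show ?thesis
    using blocks_in_image[OF p(1) assms(4) AS] by (simp add: is_factor_def)
qed

text \<open>\<open>compo_assoc\<close> is applied to C, with the parts of \<beta> and \<alpha>
  inside C. One element \<kappa>' witnesses both conclusions; this sharing allows uniqueness to
  identify it later with a decoration produced by \<phi>.\<close>

lemma is_factor_trans:
  assumes "fin_set S" "refines S \<beta> \<alpha>" "refines S \<alpha> \<gamma>" "C \<in> \<gamma>" "\<xi> \<in> decorations Q \<beta>"
    and \<theta>: "\<theta> \<in> decorations Q (part_phi \<beta> \<alpha>)"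
    and fac: "\<And>A. A \<in> \<alpha> \<Longrightarrow> is_factor Q \<beta> \<xi> A (\<eta> A) (\<theta> (pts (blocks_in \<beta> A)))"
    and "is_factor Q \<alpha> \<eta> C z \<kappa>"
  obtains \<kappa>' where "is_factor Q \<beta> \<xi> C z \<kappa>'"
    "is_factor Q (part_phi \<beta> \<alpha>) \<theta> (pts (blocks_in \<beta> C)) \<kappa>' (act Q (pts (blocks_in \<alpha> C)) (ident \<beta>) \<kappa>)"
proof -
  define b a where "b = blocks_in \<beta> C" and "a = blocks_in \<alpha> C"
  define \<rho> where "\<rho> = part_phi \<beta> a"
  \<comment> \<open>The inner composite on the right side of \<open>compo_assoc\<close>: \<kappa> is
    moved from the blocks of \<alpha> inside C to the blocks of \<rho>, then composed with the
    quotients \<theta>.\<close>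
  define \<kappa>' where "\<kappa>' = compo Q \<rho> (act Q (pts a) (ident \<beta>) \<kappa>) (restrict \<theta> \<rho>)"
  have S: "finite S" using assms(1) by (simp add: fin_set_def)
  have \<beta>\<gamma>: "refines S \<beta> \<gamma>" using assms refines_trans by blast
  have C: "fin_set C" using assms fin_set_block refinesD by blast
  then have fC: "finite C" by (simp add: fin_set_def)
  have ba: "refines C b a" unfolding b_def a_def using assms refines_blocks_in by blast
  note p = refinesD[OF ba]
  have \<rho>: "\<rho> = part_phi b a" by (simp add: \<rho>_def b_def a_def part_phi_blocks_in)
  have \<rho>': "blocks_in (part_phi \<beta> \<alpha>) (pts b) = \<rho>"
    unfolding \<rho>_def b_def a_def using S assms \<beta>\<gamma> blocks_in_part_phi by blast
  have \<theta>\<rho>: "restrict \<theta> \<rho> \<in> decorations Q \<rho>"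
    using \<theta> \<rho>' blocks_in_subset decorations_restrict by metis
  have \<kappa>: "\<kappa> \<in> ops Q (pts a)" "z = compo Q a \<kappa> (restrict \<eta> a)"
    using assms(8) by (auto simp: is_factor_def a_def)
  have fa: "finite A" if "A \<in> a" for A using that fC p finite_block by blast
  \<comment> \<open>The axiom on C produces \<open>ident b\<close>, the conclusion speaks of
    \<open>ident \<beta>\<close>. A block of \<alpha> inside C contains the same blocks of b and of
    \<beta>, and \<open>act_cong\<close> turns this into equality of the actions.\<close>
  have idc: "ident b s = ident \<beta> s" if "s \<in> pts a" for s
  proof -
    obtain A where A: "A \<in> a" "s = blk A" using \<open>s \<in> pts a\<close> by (auto simp: pts_def)
    then have "A \<subseteq> C" by (simp add: a_def blocks_in_def)
    then show ?thesis using A fa by (simp add: ident_blk b_def blocks_in_blocks_in)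
  qed
  have inj: "inj_on (ident b) (pts a)" using fC ba inj_on_ident by blast
  have act: "act Q (pts a) (ident b) \<kappa> = act Q (pts a) (ident \<beta>) \<kappa>"
    using C p inj \<kappa> idc by (intro act_cong fin_set_pts)
  have "act Q (pts a) (ident b) \<kappa> \<in> ops Q (ident b ` pts a)"
    using C p inj \<kappa> by (intro act_closed fin_set_pts)
  moreover have "ident b ` pts a = pts \<rho>" unfolding \<rho> using fa by (rule ident_image_pts)
  ultimately have act_ops: "act Q (pts a) (ident \<beta>) \<kappa> \<in> ops Q (pts \<rho>)" by (simp add: act)
  have "partition_on (pts b) \<rho>" unfolding \<rho> using fC ba partition_part_phi by blast
  then have \<kappa>'_ops: "\<kappa>' \<in> ops Q (pts b)"
    unfolding \<kappa>'_def using C p act_ops \<theta>\<rho> by (intro compo_closed fin_set_pts)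
  \<comment> \<open>Replacing each decoration by its factorization brings z into the shape of the
    left side of \<open>compo_assoc\<close>.\<close>
  have "restrict \<eta> a = (\<lambda>A\<in>a. compo Q (blocks_in b A) (restrict \<theta> \<rho> (pts (blocks_in b A)))
                                (restrict (restrict \<xi> b) (blocks_in b A)))"
  proof (rule restrict_ext)
    fix A assume A: "A \<in> a"
    then have AC: "A \<subseteq> C" "A \<in> \<alpha>" by (auto simp: a_def blocks_in_def)
    have "blocks_in b A = blocks_in \<beta> A" using AC by (simp add: b_def blocks_in_blocks_in)
    moreover have "b \<inter> blocks_in \<beta> A = blocks_in \<beta> A" using AC by (auto simp: b_def blocks_in_def)
    moreover have "pts (blocks_in \<beta> A) \<in> \<rho>" using A by (auto simp: \<rho>_def part_phi_def)
    ultimately show "\<eta> A = compo Q (blocks_in b A) (restrict \<theta> \<rho> (pts (blocks_in b A)))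
        (restrict (restrict \<xi> b) (blocks_in b A))"
      using fac[OF AC(2)] by (simp add: is_factor_def)
  qed
  then have "z = compo Q b (compo Q \<rho> (act Q (pts a) (ident b) \<kappa>) (restrict \<theta> \<rho>)) (restrict \<xi> b)"
    using compo_assoc[OF C ba \<kappa>(1), of "restrict \<theta> \<rho>" "restrict \<xi> b"] \<theta>\<rho> \<kappa>(2)
      decorations_restrict[OF assms(5), of b] by (simp add: \<rho> b_def blocks_in_subset)
  then have "is_factor Q \<beta> \<xi> C z \<kappa>'"
    using \<kappa>'_ops by (simp add: is_factor_def act[unfolded b_def] \<kappa>'_def b_def)
  moreover have "is_factor Q (part_phi \<beta> \<alpha>) \<theta> (pts (blocks_in \<beta> C)) \<kappa>' (act Q (pts (blocks_in \<alpha> C)) (ident \<beta>) \<kappa>)"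
    using act_ops \<rho>' by (simp add: is_factor_def \<kappa>'_def a_def b_def)
  ultimately show ?thesis using that by blast
qed

end

section \<open>Decorated partitions of a right-basic operad\<close>

locale right_basic_operad = set_operad Q for Q :: "('a, 'q) set_operad_data" +
  assumes finite_ops: "fin_set S \<Longrightarrow> finite (ops Q S)"
    and ops_nonempty: "fin_set S \<Longrightarrow> ops Q S \<noteq> {}"
    and ops_singleton: "ops Q {s} = {unit_op Q s}"
    and right_basic: "right_basic Q"
begin

text \<open>Right-basicness is used on the block A as a finite set in its own right, decorated by
  the part of (\<beta>, \<xi>) inside A.\<close>

lemma is_factor_unique:
  assumes "fin_set S" "refines S \<beta> \<alpha>" "A \<in> \<alpha>" "\<xi> \<in> decorations Q \<beta>"
    and "is_factor Q \<beta> \<xi> A q \<nu>" "is_factor Q \<beta> \<xi> A q \<nu>'"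
  shows "\<nu> = \<nu>'"
proof -
  have "fin_set A" using assms fin_set_block refinesD by blast
  moreover have "(blocks_in \<beta> A, restrict \<xi> (blocks_in \<beta> A)) \<in> dec_partitions Q A"
    using partition_blocks_in[OF assms(2,3)] decorations_restrict[OF assms(4) blocks_in_subset]
    by (simp add: dec_partitions_iff)
  ultimately have "inj_on (\<lambda>\<nu>. compo Q (blocks_in \<beta> A) \<nu> (restrict \<xi> (blocks_in \<beta> A))) (ops Q (pts (blocks_in \<beta> A)))"
    using right_basic unfolding right_basic_def by fast
  then show ?thesis by (rule inj_onD) (use assms(5,6) in \<open>auto simp: is_factor_def\<close>)
qed

section \<open>The quotient decoration\<close>

lemma dec_phi_eqI:
  assumes "fin_set S" "((\<alpha>, \<eta>), (\<pi>, \<xi>)) \<in> dec_leq Q S" "\<theta> \<in> decorations Q (part_phi \<pi> \<alpha>)"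
    and "\<And>A. A \<in> \<alpha> \<Longrightarrow> is_factor Q \<pi> \<xi> A (\<eta> A) (\<theta> (pts (blocks_in \<pi> A)))"
  shows "dec_phi Q S (\<pi>, \<xi>) (\<alpha>, \<eta>) = (part_phi \<pi> \<alpha>, \<theta>)"
proof -
  have r: "refines S \<pi> \<alpha>" and \<xi>: "\<xi> \<in> decorations Q \<pi>" using assms(2) by (auto simp: dec_leq_iff)
  have S: "finite S" using assms(1) by (simp add: fin_set_def)
  have "(THE \<nu>. \<exists>A\<in>\<alpha>. C = pts (blocks_in \<pi> A) \<and> \<nu> \<in> ops Q C \<and>
         \<eta> A = compo Q (blocks_in \<pi> A) \<nu> (restrict \<xi> (blocks_in \<pi> A))) = \<theta> C" (is "The ?P = _")
    if C: "C \<in> part_phi \<pi> \<alpha>" for C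
  proof -
    obtain A where A: "A \<in> \<alpha>" "C = pts (blocks_in \<pi> A)" using C by (auto simp: part_phi_def)
    \<comment> \<open>The definite description quantifies over blocks as well. Injectivity of
      \<open>A \<mapsto> pts (blocks_in \<pi> A)\<close> leaves one block, after which uniqueness of
      factors leaves one value.\<close>
    have "A' = A" if "A' \<in> \<alpha>" "C = pts (blocks_in \<pi> A')" for A'
      using inj_onD[OF inj_on_pts_blocks_in[OF S r], of A' A] that A by simp
    then have "?P = is_factor Q \<pi> \<xi> A (\<eta> A)"
      using A unfolding is_factor_def by blast
    then show ?thesis
      using assms(4)[OF A(1)] is_factor_unique[OF assms(1) r A(1) \<xi>] A(2)
      by (simp only:) (rule the_equality)
  qed
  moreover have "restrict \<theta> (part_phi \<pi> \<alpha>) = \<theta>"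
    using assms(3) by (auto simp: decorations_def)
  ultimately show ?thesis by (simp add: dec_phi_def cong: restrict_cong)
qed

lemma dec_phiE:
  assumes "fin_set S" "((\<alpha>, \<eta>), (\<pi>, \<xi>)) \<in> dec_leq Q S"
  obtains \<theta> where "dec_phi Q S (\<pi>, \<xi>) (\<alpha>, \<eta>) = (part_phi \<pi> \<alpha>, \<theta>)"
    "\<theta> \<in> decorations Q (part_phi \<pi> \<alpha>)"
    "\<And>A. A \<in> \<alpha> \<Longrightarrow> is_factor Q \<pi> \<xi> A (\<eta> A) (\<theta> (pts (blocks_in \<pi> A)))"
proof -
  have r: "refines S \<pi> \<alpha>" using assms(2) by (auto simp: dec_leq_iff)
  have S: "finite S" using assms(1) by (simp add: fin_set_def)
  obtain N where N: "\<And>A. A \<in> \<alpha> \<Longrightarrow> is_factor Q \<pi> \<xi> A (\<eta> A) (N A)"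
    using assms(2) unfolding dec_leq_iff by metis
  \<comment> \<open>Factors are chosen per block A of \<alpha>, but the decoration is indexed by the
    sets \<open>pts (blocks_in \<pi> A)\<close>, so A is recovered by inverting this
    indexing.\<close>
  define \<theta> where "\<theta> = (\<lambda>C\<in>part_phi \<pi> \<alpha>. N (the_inv_into \<alpha> (\<lambda>A. pts (blocks_in \<pi> A)) C))"
  have \<theta>: "\<theta> (pts (blocks_in \<pi> A)) = N A" if "A \<in> \<alpha>" for A
    using that the_inv_into_f_f[OF inj_on_pts_blocks_in[OF S r]] by (simp add: \<theta>_def part_phi_def)
  have "\<theta> \<in> decorations Q (part_phi \<pi> \<alpha>)" unfolding decorations_def
  proof (rule PiE_I)
    fix C assume "C \<in> part_phi \<pi> \<alpha>"
    then obtain A where "A \<in> \<alpha>" "C = pts (blocks_in \<pi> A)" by (auto simp: part_phi_def)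
    then show "\<theta> C \<in> ops Q C" using \<theta> N by (auto simp: is_factor_def)
  qed (simp add: \<theta>_def)
  then show ?thesis using dec_phi_eqI[OF assms] \<theta> N that by simp
qed

text \<open>The factor is an operation on the single point \<open>blk A\<close>, and arity one
  contains only the unit.\<close>

lemma is_factor_self_iff:
  assumes "fin_set S" "partition_on S \<pi>" "\<xi> \<in> decorations Q \<pi>" "A \<in> \<pi>"
  shows "is_factor Q \<pi> \<xi> A q \<nu> \<longleftrightarrow> q = \<xi> A \<and> \<nu> = unit_op Q (blk A)"
  using is_factor_self[OF assms] assms(2,4)
  by (auto simp: is_factor_def blocks_in_self pts_singleton ops_singleton)

section \<open>The order on decorated partitions\<close>

lemma dec_leq_refl: "fin_set S \<Longrightarrow> x \<in> dec_partitions Q S \<Longrightarrow> (x, x) \<in> dec_leq Q S"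
  by (cases x) (auto simp: dec_leq_iff dec_partitions_iff refines_refl intro: is_factor_self)

text \<open>Stronger than antisymmetry: one inequality suffices once the underlying partitions
  agree. In this form it also lifts minimality and maximality from partitions to decorated
  partitions.\<close>

lemma dec_leq_antisym:
  assumes "fin_set S" "(x, y) \<in> dec_leq Q S" "fst x = fst y"
  shows "x = y"
proof -
  obtain \<alpha> \<eta> \<xi> where xy: "x = (\<alpha>, \<eta>)" "y = (\<alpha>, \<xi>)" using assms(3) by (metis prod.collapse)
  then have d: "partition_on S \<alpha>" "\<eta> \<in> decorations Q \<alpha>" "\<xi> \<in> decorations Q \<alpha>"
    and "\<And>A. A \<in> \<alpha> \<Longrightarrow> \<exists>\<nu>. is_factor Q \<alpha> \<xi> A (\<eta> A) \<nu>"
    using assms(2) refinesD by (auto simp: dec_leq_iff)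
  then have "\<eta> A = \<xi> A" if "A \<in> \<alpha>" for A
    using that is_factor_self_iff[OF assms(1) d(1,3)] by blast
  then show ?thesis using d decorations_eqI xy by blast
qed

lemma dec_leq_trans:
  assumes "fin_set S" "(y, x) \<in> dec_leq Q S" "(x, x') \<in> dec_leq Q S"
  shows "(y, x') \<in> dec_leq Q S"
proof -
  obtain \<gamma> \<zeta> \<alpha> \<eta> \<beta> \<xi> where v: "y = (\<gamma>, \<zeta>)" "x = (\<alpha>, \<eta>)" "x' = (\<beta>, \<xi>)" by (metis prod.collapse)
  note l1 = assms(2)[unfolded v dec_leq_iff] and l2 = assms(3)[unfolded v dec_leq_iff]
  \<comment> \<open>The decoration produced by \<phi> serves as a simultaneous choice of factors,
    already indexed as \<open>is_factor_trans\<close> expects.\<close>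
  obtain \<theta> where \<theta>: "\<theta> \<in> decorations Q (part_phi \<beta> \<alpha>)"
    "\<And>A. A \<in> \<alpha> \<Longrightarrow> is_factor Q \<beta> \<xi> A (\<eta> A) (\<theta> (pts (blocks_in \<beta> A)))"
    using assms(1,3) v dec_phiE by metis
  have "\<exists>\<nu>. is_factor Q \<beta> \<xi> C (\<zeta> C) \<nu>" if "C \<in> \<gamma>" for C
    using that l1 l2 is_factor_trans[OF assms(1) _ _ that _ \<theta>] by metis
  then show ?thesis using l1 l2 refines_trans by (auto simp: v dec_leq_iff)
qed

text \<open>Right cancellation turns the factorization through \<open>x\<close> into one between the images of
  \<open>\<phi>\<close>; the factor is transported along the identification \<open>ident\<close>.\<close>

lemma dec_phi_chain:
  assumes "fin_set S" "((\<gamma>, \<zeta>), (\<alpha>, \<eta>)) \<in> dec_leq Q S" "((\<alpha>, \<eta>), (\<beta>, \<xi>)) \<in> dec_leq Q S"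
  obtains \<theta> \<tau> where "dec_phi Q S (\<beta>, \<xi>) (\<alpha>, \<eta>) = (part_phi \<beta> \<alpha>, \<theta>)"
    "dec_phi Q S (\<beta>, \<xi>) (\<gamma>, \<zeta>) = (part_phi \<beta> \<gamma>, \<tau>)"
    "((part_phi \<beta> \<gamma>, \<tau>), (part_phi \<beta> \<alpha>, \<theta>)) \<in> dec_leq Q (pts \<beta>)"
    "\<And>C \<kappa>. C \<in> \<gamma> \<Longrightarrow> is_factor Q \<alpha> \<eta> C (\<zeta> C) \<kappa> \<Longrightarrow>
      is_factor Q (part_phi \<beta> \<alpha>) \<theta> (pts (blocks_in \<beta> C)) (\<tau> (pts (blocks_in \<beta> C)))
        (act Q (pts (blocks_in \<alpha> C)) (ident \<beta>) \<kappa>)"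
proof -
  note l1 = assms(2)[unfolded dec_leq_iff] and l2 = assms(3)[unfolded dec_leq_iff]
  have l3: "((\<gamma>, \<zeta>), (\<beta>, \<xi>)) \<in> dec_leq Q S" using assms dec_leq_trans by blast
  have S: "finite S" using assms(1) by (simp add: fin_set_def)
  obtain \<theta> where \<theta>: "dec_phi Q S (\<beta>, \<xi>) (\<alpha>, \<eta>) = (part_phi \<beta> \<alpha>, \<theta>)" "\<theta> \<in> decorations Q (part_phi \<beta> \<alpha>)"
    "\<And>A. A \<in> \<alpha> \<Longrightarrow> is_factor Q \<beta> \<xi> A (\<eta> A) (\<theta> (pts (blocks_in \<beta> A)))"
    using assms(1,3) dec_phiE by metis
  obtain \<tau> where \<tau>: "dec_phi Q S (\<beta>, \<xi>) (\<gamma>, \<zeta>) = (part_phi \<beta> \<gamma>, \<tau>)" "\<tau> \<in> decorations Q (part_phi \<beta> \<gamma>)"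
    "\<And>C. C \<in> \<gamma> \<Longrightarrow> is_factor Q \<beta> \<xi> C (\<zeta> C) (\<tau> (pts (blocks_in \<beta> C)))"
    using assms(1) l3 dec_phiE by metis
  have fac: "is_factor Q (part_phi \<beta> \<alpha>) \<theta> (pts (blocks_in \<beta> C)) (\<tau> (pts (blocks_in \<beta> C)))
        (act Q (pts (blocks_in \<alpha> C)) (ident \<beta>) \<kappa>)"
    if C: "C \<in> \<gamma>" "is_factor Q \<alpha> \<eta> C (\<zeta> C) \<kappa>" for C \<kappa>
  proof -
    obtain \<kappa>' where \<kappa>': "is_factor Q \<beta> \<xi> C (\<zeta> C) \<kappa>'"
      "is_factor Q (part_phi \<beta> \<alpha>) \<theta> (pts (blocks_in \<beta> C)) \<kappa>' (act Q (pts (blocks_in \<alpha> C)) (ident \<beta>) \<kappa>)"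
      using is_factor_trans[OF assms(1) _ _ C(1) _ \<theta>(2,3) C(2)] l1 l2 by blast
    moreover have "\<kappa>' = \<tau> (pts (blocks_in \<beta> C))"
      using is_factor_unique[OF assms(1) _ C(1) _ \<kappa>'(1) \<tau>(3)[OF C(1)]] l3 by (auto simp: dec_leq_iff)
    ultimately show ?thesis by simp
  qed
  have "\<exists>\<nu>. is_factor Q (part_phi \<beta> \<alpha>) \<theta> E (\<tau> E) \<nu>" if "E \<in> part_phi \<beta> \<gamma>" for E
    using that fac l1 unfolding part_phi_def by blast
  then have "((part_phi \<beta> \<gamma>, \<tau>), (part_phi \<beta> \<alpha>, \<theta>)) \<in> dec_leq Q (pts \<beta>)"
    using refines_part_phi[OF S] l1 l2 \<theta>(2) \<tau>(2) by (simp add: dec_leq_iff)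
  then show ?thesis using that \<theta>(1) \<tau>(1) fac by blast
qed

lemma finite_dec_partitions: "fin_set S \<Longrightarrow> finite (dec_partitions Q S)"
proof -
  assume S: "fin_set S"
  have "dec_partitions Q S = Sigma {\<pi>. partition_on S \<pi>} (decorations Q)"
    by (auto simp: dec_partitions_def)
  moreover have "finite (decorations Q \<pi>)" if "partition_on S \<pi>" for \<pi>
    unfolding decorations_def using S that finite_elements fin_set_block finite_ops
    by (metis fin_set_def finite_PiE)
  ultimately show ?thesis
    using S finitely_many_partition_on[of S] unfolding fin_set_def
    by (metis (no_types, lifting) finite_SigmaI mem_Collect_eq)
qed

lemma partial_order_dec_leq: "fin_set S \<Longrightarrow> partial_order_on (dec_partitions Q S) (dec_leq Q S)"
  unfolding partial_order_on_def preorder_on_def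
proof (intro conjI)
  assume S: "fin_set S"
  show "dec_leq Q S \<subseteq> dec_partitions Q S \<times> dec_partitions Q S" using dec_leqD by auto
  show "refl_on (dec_partitions Q S) (dec_leq Q S)" using S dec_leq_refl by (simp add: refl_on_def)
  show "trans (dec_leq Q S)" using S dec_leq_trans by (meson transI)
  show "antisym (dec_leq Q S)"
  proof (rule antisymI)
    fix x y assume xy: "(x, y) \<in> dec_leq Q S" "(y, x) \<in> dec_leq Q S"
    then have "fst x = fst y"
      using refines_asym by (cases x; cases y) (fastforce simp: dec_leq_iff)
    then show "x = y" using S xy dec_leq_antisym by blast
  qed
qed

section \<open>Transport of the order and equivariance of \<phi>\<close>

lemma trans_dec_mem:
  assumes "fin_set S" "inj_on f S" "(\<pi>, \<xi>) \<in> dec_partitions Q S"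
  shows "((`) f ` \<pi>, push_dec Q f \<pi> \<xi>) \<in> dec_partitions Q (f ` S)"
  using assms by (simp add: dec_partitions_iff partition_image push_dec_closed)

lemma trans_dec_leq:
  assumes "fin_set S" "inj_on f S" "((\<alpha>, \<eta>), (\<beta>, \<xi>)) \<in> dec_leq Q S"
  shows "(((`) f ` \<alpha>, push_dec Q f \<alpha> \<eta>), ((`) f ` \<beta>, push_dec Q f \<beta> \<xi>)) \<in> dec_leq Q (f ` S)"
proof -
  note l = assms(3)[unfolded dec_leq_iff]
  have p: "partition_on S \<alpha>" "partition_on S \<beta>" using l refinesD by blast+
  have "\<exists>\<nu>. is_factor Q ((`) f ` \<beta>) (push_dec Q f \<beta> \<xi>) (f ` A) (push_dec Q f \<alpha> \<eta> (f ` A)) \<nu>"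
    if "A \<in> \<alpha>" for A
    using that l is_factor_push[OF assms(1) _ that assms(2)] push_dec_apply[OF p(1) assms(2) order_refl that]
    by metis
  then show ?thesis
    using l assms p by (auto simp: dec_leq_iff refines_image push_dec_closed)
qed

lemma dec_phi_image:
  assumes "fin_set S" "inj_on f S" "((\<alpha>, \<eta>), (\<beta>, \<xi>)) \<in> dec_leq Q S"
  shows "dec_phi Q (f ` S) ((`) f ` \<beta>, push_dec Q f \<beta> \<xi>) ((`) f ` \<alpha>, push_dec Q f \<alpha> \<eta>) =
    (case dec_phi Q S (\<beta>, \<xi>) (\<alpha>, \<eta>) of (\<rho>, \<theta>) \<Rightarrow>
       ((`) (blk_map f) ` \<rho>, push_dec Q (blk_map f) \<rho> \<theta>))"
proof -
  note l = assms(3)[unfolded dec_leq_iff]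
  have r: "refines S \<beta> \<alpha>" using l by blast
  note p = refinesD[OF r]
  have S: "finite S" and fS: "fin_set (f ` S)" using assms(1) by (auto simp: fin_set_def)
  obtain \<theta> where \<theta>: "dec_phi Q S (\<beta>, \<xi>) (\<alpha>, \<eta>) = (part_phi \<beta> \<alpha>, \<theta>)" "\<theta> \<in> decorations Q (part_phi \<beta> \<alpha>)"
    "\<And>A. A \<in> \<alpha> \<Longrightarrow> is_factor Q \<beta> \<xi> A (\<eta> A) (\<theta> (pts (blocks_in \<beta> A)))"
    using assms(1,3) dec_phiE by metis
  have pp: "partition_on (pts \<beta>) (part_phi \<beta> \<alpha>)" using S r partition_part_phi by blast
  have inj: "inj_on (blk_map f) (pts \<beta>)" using S p assms inj_on_blk_map by blast
  note eq = part_phi_image[OF S r assms(2)]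
  have "push_dec Q (blk_map f) (part_phi \<beta> \<alpha>) \<theta> \<in> decorations Q ((`) (blk_map f) ` part_phi \<beta> \<alpha>)"
    using push_dec_closed[OF fin_set_pts[OF assms(1) p(1)] pp inj \<theta>(2)] .
  moreover have "is_factor Q ((`) f ` \<beta>) (push_dec Q f \<beta> \<xi>) A' (push_dec Q f \<alpha> \<eta> A')
      (push_dec Q (blk_map f) (part_phi \<beta> \<alpha>) \<theta> (pts (blocks_in ((`) f ` \<beta>) A')))"
    if A': "A' \<in> (`) f ` \<alpha>" for A'
  proof -
    obtain A where A: "A \<in> \<alpha>" "A' = f ` A" using A' by blast
    then have "A \<subseteq> S" "pts (blocks_in \<beta> A) \<in> part_phi \<beta> \<alpha>"
      using partition_onD1[OF p(2)] by (auto simp: part_phi_def)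
    then show ?thesis
      using is_factor_push[OF assms(1) r A(1) assms(2) _ \<theta>(3)[OF A(1)]] l
        push_dec_apply[OF p(2) assms(2) order_refl A(1)] push_dec_apply[OF pp inj order_refl]
        blk_map_image_pts_blocks_in[OF S p(1) assms(2)] A(2) by metis
  qed
  ultimately show ?thesis
    using dec_phi_eqI[OF fS trans_dec_leq[OF assms]] \<theta>(1) by (simp add: eq)
qed

section \<open>Restriction to blocks and equivariance of \<psi>\<close>

lemma dec_leq_blocks_in:
  assumes "((\<alpha>, \<eta>), (\<beta>, \<xi>)) \<in> dec_leq Q S" "refines S \<alpha> \<pi>" "T \<in> \<pi>"
  shows "((blocks_in \<alpha> T, restrict \<eta> (blocks_in \<alpha> T)), (blocks_in \<beta> T, restrict \<xi> (blocks_in \<beta> T))) \<in> dec_leq Q T"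
proof -
  note l = assms(1)[unfolded dec_leq_iff]
  have "\<exists>\<nu>. is_factor Q (blocks_in \<beta> T) (restrict \<xi> (blocks_in \<beta> T)) A (restrict \<eta> (blocks_in \<alpha> T) A) \<nu>"
    if "A \<in> blocks_in \<alpha> T" for A
    using that l by (simp add: is_factor_restrict blocks_in_def[of \<alpha>])
  then show ?thesis
    using l assms refines_blocks_in[of S \<beta> \<alpha>] blocks_in_subset[of \<alpha>] blocks_in_subset[of \<beta>]
    by (auto simp: dec_leq_iff decorations_restrict)
qed

lemma dec_psi_apply:
  "T \<in> \<pi> \<Longrightarrow> dec_psi S (\<pi>, \<xi>) (\<beta>, \<nu>) T = (blocks_in \<beta> T, restrict \<nu> (blocks_in \<beta> T))"
  by (simp add: dec_psi_def)

lemma dec_psi_image: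
  assumes "fin_set S" "inj_on f S" "((\<alpha>, \<eta>), (\<beta>, \<xi>)) \<in> dec_leq Q S" "T \<in> \<alpha>"
  shows "dec_psi (f ` S) ((`) f ` \<alpha>, push_dec Q f \<alpha> \<eta>) ((`) f ` \<beta>, push_dec Q f \<beta> \<xi>) (f ` T) =
    (case dec_psi S (\<alpha>, \<eta>) (\<beta>, \<xi>) T of (\<rho>, \<theta>) \<Rightarrow> ((`) f ` \<rho>, push_dec Q f \<rho> \<theta>))"
proof -
  have p: "partition_on S \<alpha>" "partition_on S \<beta>" using assms(3) refinesD by (auto simp: dec_leq_iff)
  then have "blocks_in ((`) f ` \<beta>) (f ` T) = (`) f ` blocks_in \<beta> T"
    using assms partition_onD1[OF p(1)] by (intro blocks_in_image) auto
  then show ?thesis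
    using assms(4) by (simp add: dec_psi_apply push_dec_restrict[OF p(2) assms(2) blocks_in_subset])
qed

section \<open>Associativity of \<phi> and its exchange with \<psi>\<close>

lemma dec_phi_dec_phi:
  assumes "fin_set S" "((\<gamma>, \<zeta>), (\<alpha>, \<eta>)) \<in> dec_leq Q S" "((\<alpha>, \<eta>), (\<beta>, \<xi>)) \<in> dec_leq Q S"
  shows "dec_phi Q (pts \<beta>) (dec_phi Q S (\<beta>, \<xi>) (\<alpha>, \<eta>)) (dec_phi Q S (\<beta>, \<xi>) (\<gamma>, \<zeta>)) =
    (case dec_phi Q S (\<alpha>, \<eta>) (\<gamma>, \<zeta>) of (\<rho>, \<kappa>) \<Rightarrow>
       ((`) (ident \<beta>) ` \<rho>, push_dec Q (ident \<beta>) \<rho> \<kappa>))"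
proof -
  have r: "refines S \<beta> \<alpha>" "refines S \<alpha> \<gamma>" using assms by (auto simp: dec_leq_iff)
  have S: "finite S" using assms(1) by (simp add: fin_set_def)
  obtain \<theta> \<tau> where ch: "dec_phi Q S (\<beta>, \<xi>) (\<alpha>, \<eta>) = (part_phi \<beta> \<alpha>, \<theta>)"
    "dec_phi Q S (\<beta>, \<xi>) (\<gamma>, \<zeta>) = (part_phi \<beta> \<gamma>, \<tau>)"
    "((part_phi \<beta> \<gamma>, \<tau>), (part_phi \<beta> \<alpha>, \<theta>)) \<in> dec_leq Q (pts \<beta>)"
    "\<And>C \<kappa>. C \<in> \<gamma> \<Longrightarrow> is_factor Q \<alpha> \<eta> C (\<zeta> C) \<kappa> \<Longrightarrow>
      is_factor Q (part_phi \<beta> \<alpha>) \<theta> (pts (blocks_in \<beta> C)) (\<tau> (pts (blocks_in \<beta> C)))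
        (act Q (pts (blocks_in \<alpha> C)) (ident \<beta>) \<kappa>)"
    using dec_phi_chain[OF assms] by metis
  obtain \<kappa> where \<kappa>: "dec_phi Q S (\<alpha>, \<eta>) (\<gamma>, \<zeta>) = (part_phi \<alpha> \<gamma>, \<kappa>)" "\<kappa> \<in> decorations Q (part_phi \<alpha> \<gamma>)"
    "\<And>C. C \<in> \<gamma> \<Longrightarrow> is_factor Q \<alpha> \<eta> C (\<zeta> C) (\<kappa> (pts (blocks_in \<alpha> C)))"
    using dec_phiE[OF assms(1,2)] by metis
  have pp: "partition_on (pts \<alpha>) (part_phi \<alpha> \<gamma>)" using S r partition_part_phi by blast
  have inj: "inj_on (ident \<beta>) (pts \<alpha>)" using S r inj_on_ident by blast
  note fins = fin_set_pts[OF assms(1)] and eq = part_phi_part_phi[OF S r]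
  \<comment> \<open>The candidate is the decoration of \<phi> at (\<alpha>, \<eta>), moved along
    \<open>ident \<beta>\<close>. Its value on the block coming from C is exactly the factor that
    \<open>dec_phi_chain\<close> supplies for C.\<close>
  have "push_dec Q (ident \<beta>) (part_phi \<alpha> \<gamma>) \<kappa> \<in> decorations Q (part_phi (part_phi \<beta> \<alpha>) (part_phi \<beta> \<gamma>))"
    unfolding eq using fins refinesD(2)[OF r(1)] pp inj \<kappa>(2) by (blast intro: push_dec_closed)
  moreover have "is_factor Q (part_phi \<beta> \<alpha>) \<theta> E (\<tau> E)
      (push_dec Q (ident \<beta>) (part_phi \<alpha> \<gamma>) \<kappa> (pts (blocks_in (part_phi \<beta> \<alpha>) E)))"
    if E: "E \<in> part_phi \<beta> \<gamma>" for E
  proof -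
    obtain C where C: "C \<in> \<gamma>" "E = pts (blocks_in \<beta> C)" using E by (auto simp: part_phi_def)
    then have "pts (blocks_in \<alpha> C) \<in> part_phi \<alpha> \<gamma>" by (auto simp: part_phi_def)
    then show ?thesis
      using ch(4)[OF C(1) \<kappa>(3)[OF C(1)]] C(2)
      by (simp add: pts_part_phi_blocks_in[OF S r C(1)] push_dec_apply[OF pp inj order_refl])
  qed
  ultimately show ?thesis
    using dec_phi_eqI[OF fins[OF refinesD(1)[OF r(1)]] ch(3)] ch(1,2) \<kappa>(1) eq by simp
qed

text \<open>Both sides carry the restriction of one decoration \<tau>: on the left by definition of
  \<psi>, on the right because a factor over C inside T is unchanged when everything is cut down to
  T.\<close>

lemma dec_psi_dec_phi:
  assumes "fin_set S" "((\<alpha>, \<eta>), (\<gamma>, \<zeta>)) \<in> dec_leq Q S" "((\<gamma>, \<zeta>), (\<beta>, \<xi>)) \<in> dec_leq Q S"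
    "T \<in> \<alpha>"
  shows "dec_psi (pts \<beta>) (dec_phi Q S (\<beta>, \<xi>) (\<alpha>, \<eta>)) (dec_phi Q S (\<beta>, \<xi>) (\<gamma>, \<zeta>)) (pts (blocks_in \<beta> T)) =
    dec_phi Q T (dec_psi S (\<alpha>, \<eta>) (\<beta>, \<xi>) T) (dec_psi S (\<alpha>, \<eta>) (\<gamma>, \<zeta>) T)"
proof -
  have r: "refines S \<beta> \<gamma>" "refines S \<gamma> \<alpha>" using assms by (auto simp: dec_leq_iff)
  then have r': "refines S \<beta> \<alpha>" using refines_trans by blast
  have S: "finite S" and T: "fin_set T"
    using assms(1,4) fin_set_block refinesD(2)[OF r(2)] by (auto simp: fin_set_def)
  obtain \<theta> where \<theta>: "dec_phi Q S (\<beta>, \<xi>) (\<alpha>, \<eta>) = (part_phi \<beta> \<alpha>, \<theta>)"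
    using dec_phiE[OF assms(1) dec_leq_trans[OF assms(1-3)]] by metis
  obtain \<tau> where \<tau>: "dec_phi Q S (\<beta>, \<xi>) (\<gamma>, \<zeta>) = (part_phi \<beta> \<gamma>, \<tau>)" "\<tau> \<in> decorations Q (part_phi \<beta> \<gamma>)"
    "\<And>C. C \<in> \<gamma> \<Longrightarrow> is_factor Q \<beta> \<xi> C (\<zeta> C) (\<tau> (pts (blocks_in \<beta> C)))"
    using dec_phiE[OF assms(1,3)] by metis
  define \<rho> where "\<rho> = part_phi (blocks_in \<beta> T) (blocks_in \<gamma> T)"
  have \<rho>: "blocks_in (part_phi \<beta> \<gamma>) (pts (blocks_in \<beta> T)) = \<rho>"
    using blocks_in_part_phi[OF S r(1) r' assms(4)] by (simp add: \<rho>_def part_phi_blocks_in)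
  have "restrict \<tau> \<rho> \<in> decorations Q \<rho>"
    using \<tau>(2) decorations_restrict blocks_in_subset \<rho> by metis
  moreover have "is_factor Q (blocks_in \<beta> T) (restrict \<xi> (blocks_in \<beta> T)) C
      (restrict \<zeta> (blocks_in \<gamma> T) C) (restrict \<tau> \<rho> (pts (blocks_in (blocks_in \<beta> T) C)))"
    if C: "C \<in> blocks_in \<gamma> T" for C
  proof -
    have "C \<in> \<gamma>" "C \<subseteq> T" using C by (auto simp: blocks_in_def)
    moreover from this have "pts (blocks_in \<beta> C) \<in> \<rho>"
      using C by (simp only: \<rho>_def part_phi_blocks_in) (simp add: part_phi_def)
    ultimately show ?thesis
      using \<tau>(3) C by (simp add: is_factor_restrict blocks_in_blocks_in)
  qed
  ultimately have "dec_phi Q T (blocks_in \<beta> T, restrict \<xi> (blocks_in \<beta> T))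
      (blocks_in \<gamma> T, restrict \<zeta> (blocks_in \<gamma> T)) = (\<rho>, restrict \<tau> \<rho>)"
    using dec_phi_eqI[OF T dec_leq_blocks_in[OF assms(3) r(2) assms(4)]] by (simp add: \<rho>_def)
  \<comment> \<open>\<open>dec_psi\<close> is extensional, so its index must be a block of its first
    argument for the value to be meaningful.\<close>
  moreover have "pts (blocks_in \<beta> T) \<in> part_phi \<beta> \<alpha>" using assms(4) by (auto simp: part_phi_def)
  ultimately show ?thesis using assms(4) \<theta> \<tau>(1) \<rho> by (simp add: dec_psi_apply)
qed

section \<open>Functoriality of transport\<close>

lemma push_dec_cong:
  assumes "fin_set S" "partition_on S \<pi>" "inj_on f S" "\<xi> \<in> decorations Q \<pi>" "\<And>s. s \<in> S \<Longrightarrow> f s = g s"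
  shows "(`) f ` \<pi> = (`) g ` \<pi>" "push_dec Q f \<pi> \<xi> = push_dec Q g \<pi> \<xi>"
proof -
  have sub: "T \<subseteq> S" if "T \<in> \<pi>" for T using that partition_onD1[OF assms(2)] by auto
  have im: "f ` T = g ` T" if "T \<in> \<pi>" for T using sub[OF that] assms(5) by (intro image_cong) auto
  then show eq: "(`) f ` \<pi> = (`) g ` \<pi>" by (rule image_cong[OF refl])
  have g: "inj_on g S" using assms(3,5) by (metis inj_on_cong)
  show "push_dec Q f \<pi> \<xi> = push_dec Q g \<pi> \<xi>"
  proof (rule decorations_eqI)
    show "push_dec Q f \<pi> \<xi> \<in> decorations Q ((`) f ` \<pi>)" "push_dec Q g \<pi> \<xi> \<in> decorations Q ((`) f ` \<pi>)"
      using push_dec_closed[OF assms(1-4)] push_dec_closed[OF assms(1,2) g assms(4)] eq by simp_all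
    fix T' assume "T' \<in> (`) f ` \<pi>"
    then obtain T where T: "T \<in> \<pi>" "T' = f ` T" by blast
    have "act Q T f (\<xi> T) = act Q T g (\<xi> T)"
      using T(1) sub[OF T(1)] assms(5)
      by (intro act_cong fin_set_block[OF assms(1,2)] decorationsD[OF assms(4)] inj_on_subset[OF assms(3)]) auto
    then show "push_dec Q f \<pi> \<xi> T' = push_dec Q g \<pi> \<xi> T'"
      using T(2) im[OF T(1)] push_dec_apply[OF assms(2,3) order_refl T(1), of Q \<xi>]
        push_dec_apply[OF assms(2) g order_refl T(1), of Q \<xi>] by simp
  qed
qed

lemma push_dec_id:
  assumes "fin_set S" "partition_on S \<pi>" "\<xi> \<in> decorations Q \<pi>"
  shows "push_dec Q id \<pi> \<xi> = \<xi>"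
proof (rule decorations_eqI)
  show "push_dec Q id \<pi> \<xi> \<in> decorations Q \<pi>" using push_dec_closed[OF assms(1,2) inj_on_id assms(3)] by simp
  show "push_dec Q id \<pi> \<xi> T = \<xi> T" if "T \<in> \<pi>" for T
    using push_dec_apply[OF assms(2) inj_on_id order_refl that, of Q \<xi>]
      act_id[OF fin_set_block[OF assms(1,2) that] decorationsD[OF assms(3) that]] by simp
qed (rule assms)

lemma push_dec_comp:
  assumes "fin_set S" "partition_on S \<pi>" "inj_on f S" "inj_on g (f ` S)" "\<xi> \<in> decorations Q \<pi>"
  shows "push_dec Q (g \<circ> f) \<pi> \<xi> = push_dec Q g ((`) f ` \<pi>) (push_dec Q f \<pi> \<xi>)"
proof (rule decorations_eqI)
  have gf: "inj_on (g \<circ> f) S" using assms comp_inj_on by blast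
  have p: "partition_on (f ` S) ((`) f ` \<pi>)" using assms partition_image by blast
  have eq: "(`) (g \<circ> f) ` \<pi> = (`) g ` (`) f ` \<pi>" by (simp add: image_image image_comp)
  show "push_dec Q (g \<circ> f) \<pi> \<xi> \<in> decorations Q ((`) (g \<circ> f) ` \<pi>)"
    by (rule push_dec_closed[OF assms(1,2) gf assms(5)])
  have "fin_set (f ` S)" using assms(1) by (simp add: fin_set_def)
  then show "push_dec Q g ((`) f ` \<pi>) (push_dec Q f \<pi> \<xi>) \<in> decorations Q ((`) (g \<circ> f) ` \<pi>)"
    unfolding eq using p assms(4) push_dec_closed[OF assms(1-3,5)] by (rule push_dec_closed)
  fix T' assume "T' \<in> (`) (g \<circ> f) ` \<pi>"
  then obtain T where T: "T \<in> \<pi>" "T' = (g \<circ> f) ` T" by blast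
  have TS: "T \<subseteq> S" using T(1) partition_onD1[OF assms(2)] by auto
  have "act Q T (g \<circ> f) (\<xi> T) = act Q (f ` T) g (act Q T f (\<xi> T))"
    using T(1) TS
    by (intro act_comp fin_set_block[OF assms(1,2)] decorationsD[OF assms(5)] inj_on_subset[OF assms(3)]
        inj_on_subset[OF assms(4)]) auto
  then show "push_dec Q (g \<circ> f) \<pi> \<xi> T' = push_dec Q g ((`) f ` \<pi>) (push_dec Q f \<pi> \<xi>) T'"
    using T push_dec_apply[OF assms(2) gf order_refl T(1), of Q \<xi>]
      push_dec_apply[OF assms(2,3) order_refl T(1), of Q \<xi>]
      push_dec_apply[OF p assms(4) order_refl imageI[OF T(1)], of Q "push_dec Q f \<pi> \<xi>"]
    by (simp add: image_comp)
qed

section \<open>Minimal and maximal elements\<close>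

lemma least_dec_partition:
  assumes "fin_set S" "x \<in> dec_partitions Q S"
  obtains y where "(y, x) \<in> dec_leq Q S" "fst y = {S}"
proof -
  obtain \<pi> \<xi> where x: "x = (\<pi>, \<xi>)" by fastforce
  then have p: "partition_on S \<pi>" "\<xi> \<in> decorations Q \<pi>" using assms by (auto simp: dec_partitions_iff)
  have S: "S \<noteq> {}" using assms(1) by (simp add: fin_set_def)
  \<comment> \<open>Any operation on the blocks will do: composing it with all of \<xi> decorates
    the one-block partition. The resulting y depends on x and on this choice.\<close>
  obtain \<nu> where \<nu>: "\<nu> \<in> ops Q (pts \<pi>)" using ops_nonempty fin_set_pts assms(1) p(1) by blast
  have r: "refines S \<pi> {S}"
    using p(1) partition_on_space[OF S] partition_onD1[OF p(1)] by (auto simp: refines_def)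
  have "restrict \<xi> \<pi> = \<xi>" using p(2) by (auto simp: decorations_def)
  then have "is_factor Q \<pi> \<xi> S (compo Q \<pi> \<nu> \<xi>) \<nu>"
    using \<nu> by (simp add: is_factor_def blocks_in_whole[OF p(1)])
  moreover have "compo Q \<pi> \<nu> \<xi> \<in> ops Q S" using assms(1) p \<nu> compo_closed by blast
  ultimately have "(({S}, \<lambda>T\<in>{S}. compo Q \<pi> \<nu> \<xi>), x) \<in> dec_leq Q S"
    using r p(2) x by (auto simp: dec_leq_iff decorations_def)
  then show ?thesis using that by simp
qed

lemma greatest_dec_partition:
  assumes "fin_set S" "x \<in> dec_partitions Q S"
  obtains y where "(x, y) \<in> dec_leq Q S" "fst y = singletons S"
proof -
  obtain \<pi> \<xi> where x: "x = (\<pi>, \<xi>)" by fastforce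
  then have p: "partition_on S \<pi>" "\<xi> \<in> decorations Q \<pi>" using assms by (auto simp: dec_partitions_iff)
  define u where "u = (\<lambda>T\<in>singletons S. unit_op Q (the_elem T))"
  \<comment> \<open>By the right unit axiom, an operation on A is its own quotient by units, up to
    renaming each s as the point \<open>blk {s}\<close>. The decoration u is the same for every
    x.\<close>
  have "is_factor Q (singletons S) u A (\<xi> A) (act Q A (\<lambda>s. blk {s}) (\<xi> A))" if A: "A \<in> \<pi>" for A
  proof -
    have fA: "fin_set A" "\<xi> A \<in> ops Q A" using assms A p fin_set_block decorationsD by blast+
    have AS: "A \<subseteq> S" using A partition_onD1[OF p(1)] by auto
    then have "restrict u (singletons A) = (\<lambda>T\<in>singletons A. unit_op Q (the_elem T))"
      unfolding u_def singletons_def restrict_restrict by (intro restrict_cong) auto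
    moreover have "act Q A (\<lambda>s. blk {s}) (\<xi> A) \<in> ops Q (pts (singletons A))"
      using act_closed[OF fA(1) _ fA(2), of "\<lambda>s. blk {s}"]
      by (simp add: pts_def singletons_def image_image inj_on_def blk_eq_iff)
    ultimately show ?thesis
      using unit_right[OF fA] AS by (simp add: is_factor_def blocks_in_singletons)
  qed
  moreover have "u \<in> decorations Q (singletons S)"
    by (auto simp: u_def decorations_def singletons_def unit_closed)
  moreover have "refines S (singletons S) \<pi>"
    using p(1) partition_on_singletons[of S] partition_onD1[OF p(1)]
    by (auto simp: refines_def singletons_def)
  ultimately have "(x, (singletons S, u)) \<in> dec_leq Q S" using p x by (auto simp: dec_leq_iff)
  then show ?thesis using that by simp
qed

text \<open>Over a minimal partition, anything below x has the same partition and equals x by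
  \<open>dec_leq_antisym\<close>. Conversely a minimal x must equal the one-block element found
  below it, and the one-block partition is refined by every partition.\<close>

lemma minimal_dec_partitions:
  assumes "fin_set S"
  shows "{x \<in> dec_partitions Q S. fst x \<in> minimals Part S} = minimals (Dec_Part Q) S"
proof (intro set_eqI iffI)
  fix x assume x: "x \<in> {x \<in> dec_partitions Q S. fst x \<in> minimals Part S}"
  have "y = x" if "(y, x) \<in> dec_leq Q S" for y
  proof (rule dec_leq_antisym[OF assms that])
    have "refines S (fst x) (fst y)" using that by (cases x; cases y) (simp add: dec_leq_iff)
    moreover from this have "partition_on S (fst y)" by (rule refinesD(2))
    ultimately show "fst y = fst x" using x by (simp add: minimals_def Part_def)
  qed
  then show "x \<in> minimals (Dec_Part Q) S" using x by (auto simp: minimals_def Dec_Part_def)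
next
  fix x assume x: "x \<in> minimals (Dec_Part Q) S"
  then have xd: "x \<in> dec_partitions Q S" by (simp add: minimals_def Dec_Part_def)
  obtain y where y: "(y, x) \<in> dec_leq Q S" "fst y = {S}" using least_dec_partition[OF assms xd] .
  then have "y = x" using x dec_leqD(1)[OF y(1)] by (simp add: minimals_def Dec_Part_def)
  then have "fst x = {S}" using y(2) by simp
  moreover have "partition_on S {S}" using assms by (simp add: partition_on_space fin_set_def)
  moreover have "refines S \<alpha> {S}" if "partition_on S \<alpha>" for \<alpha>
    using that \<open>partition_on S {S}\<close> partition_onD1[OF that] by (auto simp: refines_def)
  ultimately show "x \<in> {x \<in> dec_partitions Q S. fst x \<in> minimals Part S}"
    using xd by (auto simp: minimals_def Part_def intro!: refines_asym[of S])
qed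

text \<open>The dual argument: a maximal x must equal the element above it that is decorated by
  units on singletons, and the partition into singletons refines every partition.\<close>

lemma maximal_dec_partitions:
  assumes "fin_set S"
  shows "{x \<in> dec_partitions Q S. fst x \<in> maximals Part S} = maximals (Dec_Part Q) S"
proof (intro set_eqI iffI)
  fix x assume x: "x \<in> {x \<in> dec_partitions Q S. fst x \<in> maximals Part S}"
  have "x = y" if "(x, y) \<in> dec_leq Q S" for y
  proof (rule dec_leq_antisym[OF assms that])
    have "refines S (fst y) (fst x)" using that by (cases x; cases y) (simp add: dec_leq_iff)
    moreover from this have "partition_on S (fst y)" by (rule refinesD(1))
    ultimately have "fst y = fst x" using x by (simp add: maximals_def Part_def)
    then show "fst x = fst y" by simp
  qed
  then show "x \<in> maximals (Dec_Part Q) S" using x by (auto simp: maximals_def Dec_Part_def)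
next
  fix x assume x: "x \<in> maximals (Dec_Part Q) S"
  then have xd: "x \<in> dec_partitions Q S" by (simp add: maximals_def Dec_Part_def)
  obtain y where y: "(x, y) \<in> dec_leq Q S" "fst y = singletons S" using greatest_dec_partition[OF assms xd] .
  then have "y = x" using x dec_leqD(2)[OF y(1)] by (simp add: maximals_def Dec_Part_def)
  then have "fst x = singletons S" using y(2) by simp
  moreover have p: "partition_on S (singletons S)"
    unfolding singletons_def by (rule partition_on_singletons)
  moreover have "refines S (singletons S) \<beta>" if "partition_on S \<beta>" for \<beta>
    using that p partition_onD1[OF that] by (auto simp: refines_def singletons_def)
  ultimately show "x \<in> {x \<in> dec_partitions Q S. fst x \<in> maximals Part S}"
    using xd by (auto simp: maximals_def Part_def intro!: refines_asym[of S])
qed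

section \<open>Unitality and verification of the axioms\<close>

lemma partition_on_singleton_iff: "partition_on {s} \<pi> \<longleftrightarrow> \<pi> = {{s}}"
proof
  assume p: "partition_on {s} \<pi>"
  then have "T = {s}" if "T \<in> \<pi>" for T
    using that unfolding partition_on_def by (metis Sup_upper subset_singletonD)
  moreover have "\<pi> \<noteq> {}" using p by (auto simp: partition_on_def)
  ultimately show "\<pi> = {{s}}" by blast
qed (simp add: partition_on_space)

lemma dec_partitions_singleton:
  "dec_partitions Q {s} = {({{s}}, \<lambda>T\<in>{{s}}. unit_op Q s)}"
proof -
  have "decorations Q {{s}} = {\<lambda>T\<in>{{s}}. unit_op Q s}"
    unfolding decorations_def by (subst PiE_over_singleton_iff) (auto simp: ops_singleton)
  then show ?thesis by (auto simp: dec_partitions_def partition_on_singleton_iff)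
qed

lemma poset_species_Dec_Part: "poset_species (Dec_Part Q)"
proof
  fix S :: "'a hfin set" and f :: "'a hfin \<Rightarrow> 'a hfin" assume S: "fin_set S" and f: "inj_on f S"
  show "poset_hom (elems (Dec_Part Q) S) (leq (Dec_Part Q) S) (elems (Dec_Part Q) (f ` S))
     (leq (Dec_Part Q) (f ` S)) (trans_map (Dec_Part Q) S f)"
    using trans_dec_mem[OF S f] trans_dec_leq[OF S f]
    by (auto simp: Dec_Part_def poset_hom_def monotone_on_def)
next
  fix S :: "'a hfin set" and f g :: "'a hfin \<Rightarrow> 'a hfin" and x
  assume "fin_set S" "inj_on f S" "\<And>s. s \<in> S \<Longrightarrow> f s = g s" "x \<in> elems (Dec_Part Q) S"
  then show "trans_map (Dec_Part Q) S f x = trans_map (Dec_Part Q) S g x"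
    using push_dec_cong[of S "fst x" f "snd x" g] by (cases x) (simp add: Dec_Part_def dec_partitions_iff)
next
  fix S :: "'a hfin set" and f g :: "'a hfin \<Rightarrow> 'a hfin" and x
  assume "fin_set S" "inj_on f S" "inj_on g (f ` S)" "x \<in> elems (Dec_Part Q) S"
  then show "trans_map (Dec_Part Q) S (g \<circ> f) x =
      trans_map (Dec_Part Q) (f ` S) g (trans_map (Dec_Part Q) S f x)"
    using push_dec_comp[of S _ f g]
    by (cases x) (simp add: Dec_Part_def dec_partitions_iff image_image image_comp)
qed (auto simp: Dec_Part_def finite_dec_partitions partial_order_dec_leq dec_partitions_iff push_dec_id)

lemma lower_Dec_Part: "lower (Dec_Part Q) S x = {y. (y, x) \<in> dec_leq Q S}"
  by (auto simp: lower_def Dec_Part_def dest: dec_leqD)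

lemma upper_Dec_Part: "upper (Dec_Part Q) S x = {y. (x, y) \<in> dec_leq Q S}"
  by (auto simp: upper_def Dec_Part_def dest: dec_leqD)

lemma poset_hom_dec_phi:
  assumes "fin_set S" "x \<in> dec_partitions Q S"
  shows "poset_hom (lower (Dec_Part Q) S x) (dec_leq Q S)
    (dec_partitions Q (pts (fst x))) (dec_leq Q (pts (fst x))) (dec_phi Q S x)"
proof -
  have "(dec_phi Q S x y, dec_phi Q S x z) \<in> dec_leq Q (pts (fst x))"
    if yz: "(y, z) \<in> dec_leq Q S" "(z, x) \<in> dec_leq Q S" for y z
  proof -
    obtain \<gamma> \<zeta> \<alpha> \<eta> \<beta> \<xi> where v: "y = (\<gamma>, \<zeta>)" "z = (\<alpha>, \<eta>)" "x = (\<beta>, \<xi>)" by (metis prod.collapse)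
    show ?thesis using dec_phi_chain[OF assms(1) yz[unfolded v]] v by (metis fst_conv)
  qed
  \<comment> \<open>Membership is monotonicity at the reflexive pair (y, y), since the order relates
    only decorated partitions.\<close>
  moreover from this have "dec_phi Q S x y \<in> dec_partitions Q (pts (fst x))" if "(y, x) \<in> dec_leq Q S" for y
    using that assms dec_leqD dec_leq_refl by blast
  ultimately show ?thesis by (auto simp: poset_hom_def lower_Dec_Part monotone_on_def)
qed

lemma poset_hom_dec_psi:
  assumes "fin_set S" "x \<in> dec_partitions Q S"
  shows "poset_hom (upper (Dec_Part Q) S x) (dec_leq Q S)
    (prod_elems (Dec_Part Q) (fst x)) (prod_leq (Dec_Part Q) (fst x)) (dec_psi S x)"
proof -
  have mono: "(dec_psi S x y T, dec_psi S x z T) \<in> dec_leq Q T"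
    if yz: "(x, y) \<in> dec_leq Q S" "(y, z) \<in> dec_leq Q S" "T \<in> fst x" for y z T
  proof -
    obtain \<gamma> \<zeta> \<alpha> \<eta> \<beta> \<xi> where v: "x = (\<gamma>, \<zeta>)" "y = (\<alpha>, \<eta>)" "z = (\<beta>, \<xi>)" by (metis prod.collapse)
    then show ?thesis
      using yz dec_leq_blocks_in[of \<alpha> \<eta> \<beta> \<xi> S \<gamma> T] by (simp add: dec_psi_apply dec_leq_iff)
  qed
  have mem: "dec_psi S x y \<in> prod_elems (Dec_Part Q) (fst x)" if "(x, y) \<in> dec_leq Q S" for y
  proof -
    \<comment> \<open>The product is a set of extensional families. Membership of each component
      again follows from monotonicity at a reflexive pair.\<close>
    have "dec_psi S x y \<in> extensional (fst x)" by (cases x; cases y) (simp add: dec_psi_def)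
    moreover have "dec_psi S x y T \<in> dec_partitions Q T" if "T \<in> fst x" for T
      using mono[OF \<open>(x, y) \<in> dec_leq Q S\<close> _ that] dec_leq_refl[OF assms(1)] dec_leqD \<open>(x, y) \<in> dec_leq Q S\<close> by blast
    ultimately show ?thesis by (simp add: prod_elems_def Dec_Part_def PiE_iff)
  qed
  have "(dec_psi S x y, dec_psi S x z) \<in> prod_leq (Dec_Part Q) (fst x)"
    if "(x, y) \<in> dec_leq Q S" "(x, z) \<in> dec_leq Q S" "(y, z) \<in> dec_leq Q S" for y z
    using that mem mono by (simp add: prod_leq_def) (simp add: Dec_Part_def)
  then show ?thesis using mem by (auto simp: poset_hom_def upper_Dec_Part monotone_on_def)
qed

lemma operadic_poset_species_Dec_Part:
  "operadic_poset_species (Dec_Part Q) dec_forget (dec_phi Q) dec_psi"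
proof (intro operadic_poset_species.intro operadic_poset_species_axioms.intro poset_species_Dec_Part)
  have "refines S (fst y) (fst x)" if "(x, y) \<in> dec_leq Q S" for S x y
    using that by (cases x; cases y) (simp add: dec_leq_iff)
  then show "poset_species_hom (Dec_Part Q) Part dec_forget"
    by (auto simp: poset_species_hom_def poset_hom_def monotone_on_def Dec_Part_def Part_def
        dec_forget_def dec_partitions_iff)
next
  fix S :: "'a hfin set" and x assume S: "fin_set S"
  show "{x \<in> elems (Dec_Part Q) S. dec_forget S x \<in> minimals Part S} = minimals (Dec_Part Q) S"
    using minimal_dec_partitions[OF S] by (simp add: dec_forget_def Dec_Part_def)
  show "{x \<in> elems (Dec_Part Q) S. dec_forget S x \<in> maximals Part S} = maximals (Dec_Part Q) S"
    using maximal_dec_partitions[OF S] by (simp add: dec_forget_def Dec_Part_def)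
  assume x: "x \<in> elems (Dec_Part Q) S"
  obtain \<pi> \<xi> where x': "x = (\<pi>, \<xi>)" by fastforce
  have xd: "x \<in> dec_partitions Q S" using x by (simp add: Dec_Part_def)
  show "poset_hom (lower (Dec_Part Q) S x) (leq (Dec_Part Q) S) (elems (Dec_Part Q) (pts (dec_forget S x)))
      (leq (Dec_Part Q) (pts (dec_forget S x))) (dec_phi Q S x)"
    using poset_hom_dec_phi[OF S xd] by (simp add: dec_forget_def Dec_Part_def)
  show "poset_hom (upper (Dec_Part Q) S x) (leq (Dec_Part Q) S) (prod_elems (Dec_Part Q) (dec_forget S x))
      (prod_leq (Dec_Part Q) (dec_forget S x)) (dec_psi S x)"
    using poset_hom_dec_psi[OF S xd] by (simp add: dec_forget_def Dec_Part_def)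
  fix y :: "('a, 'q) dec_partition"
  obtain \<alpha> \<eta> where y': "y = (\<alpha>, \<eta>)" by fastforce
  \<comment> \<open>The definite description affects only the decoration; the partition component of
    \<open>dec_phi\<close> is explicit, so compatibility with the forgetful map is mere
    unfolding.\<close>
  show "dec_forget (pts (dec_forget S x)) (dec_phi Q S x y) = part_phi (dec_forget S x) (dec_forget S y)"
    by (simp add: x' y' dec_forget_def dec_phi_def)
  show "(\<lambda>T\<in>dec_forget S x. dec_forget T (dec_psi S x y T)) = part_psi (dec_forget S x) (dec_forget S y)"
    by (simp add: x' y' dec_forget_def dec_psi_apply part_psi_def cong: restrict_cong)
  fix f :: "'a hfin \<Rightarrow> 'a hfin" assume f: "inj_on f S"
  show "trans_map (Dec_Part Q) (pts (dec_forget S x)) (blk_map f) (dec_phi Q S x y) =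
      dec_phi Q (f ` S) (trans_map (Dec_Part Q) S f x) (trans_map (Dec_Part Q) S f y)"
    if "y \<in> lower (Dec_Part Q) S x"
    using that dec_phi_image[OF S f, of \<alpha> \<eta> \<pi> \<xi>] by (simp add: lower_Dec_Part x' y') (simp add: Dec_Part_def)
  show "trans_map (Dec_Part Q) T f (dec_psi S x y T) =
      dec_psi (f ` S) (trans_map (Dec_Part Q) S f x) (trans_map (Dec_Part Q) S f y) (f ` T)"
    if "y \<in> upper (Dec_Part Q) S x" "T \<in> dec_forget S x" for T
    using that dec_psi_image[OF S f, of \<pi> \<xi> \<alpha> \<eta> T]
    by (simp add: upper_Dec_Part x' y' dec_forget_def) (simp add: Dec_Part_def)
next
  fix s
  show "\<exists>x. elems (Dec_Part Q) {s} = {x}" by (simp add: Dec_Part_def dec_partitions_singleton)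
next
  fix S :: "'a hfin set" and x x' y :: "('a, 'q) dec_partition"
  assume S: "fin_set S" and xx': "(x, x') \<in> leq (Dec_Part Q) S"
  obtain \<gamma> \<zeta> \<alpha> \<eta> \<beta> \<xi> where v: "y = (\<gamma>, \<zeta>)" "x = (\<alpha>, \<eta>)" "x' = (\<beta>, \<xi>)" by (metis prod.collapse)
  have le: "((\<alpha>, \<eta>), (\<beta>, \<xi>)) \<in> dec_leq Q S" using xx' v by (simp add: Dec_Part_def)
  show "dec_phi Q (pts (dec_forget S x')) (dec_phi Q S x' x) (dec_phi Q S x' y) =
      trans_map (Dec_Part Q) (pts (dec_forget S x)) (ident (dec_forget S x')) (dec_phi Q S x y)"
    if "y \<in> lower (Dec_Part Q) S x"
    using that dec_phi_dec_phi[OF S _ le, of \<gamma> \<zeta>]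
    by (simp add: lower_Dec_Part v dec_forget_def) (simp add: Dec_Part_def)
  fix T assume T: "T \<in> dec_forget S x"
  show "dec_psi T (dec_psi S x x' T) (dec_psi S x y T) B = dec_psi S x' y B"
    if "B \<in> blocks_in (dec_forget S x') T" for B
  proof -
    have "B \<in> \<beta>" "B \<subseteq> T" "B \<in> blocks_in \<beta> T" "T \<in> \<alpha>"
      using that T by (auto simp: blocks_in_def dec_forget_def v)
    \<comment> \<open>Restricting first to the blocks in T and then to those in B amounts to
      restricting to B, both for the partition and for its decoration.\<close>
    moreover from this have "blocks_in \<gamma> T \<inter> blocks_in \<gamma> B = blocks_in \<gamma> B" by (auto simp: blocks_in_def)
    ultimately show ?thesis by (simp add: v dec_psi_apply blocks_in_blocks_in)
  qed
  show "dec_psi (pts (dec_forget S x')) (dec_phi Q S x' x) (dec_phi Q S x' y)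
      (pts (blocks_in (dec_forget S x') T)) = dec_phi Q T (dec_psi S x x' T) (dec_psi S x y T)"
    if "y \<in> upper (Dec_Part Q) S x" "y \<in> lower (Dec_Part Q) S x'"
    using that T dec_psi_dec_phi[OF S, of \<alpha> \<eta> \<gamma> \<zeta> \<beta> \<xi> T]
    by (simp add: lower_Dec_Part upper_Dec_Part v dec_forget_def)
qed

end

theorem proposition3p11:
  fixes Q :: "('a, 'q) set_operad_data"
  assumes "set_operad Q"
    and finite_arities: "\<And>S. fin_set S \<Longrightarrow> finite (ops Q S) \<and> ops Q S \<noteq> {}"
    and arity_zero: "ops Q {} = {}"
    and arity_one: "\<And>s. ops Q {s} = {unit_op Q s}"
    and "right_basic Q"
  shows "operadic_poset_species (Dec_Part Q) dec_forget (dec_phi Q) dec_psi"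
proof -
  have "right_basic_operad Q"
    using assms by (simp add: right_basic_operad_def right_basic_operad_axioms_def)
  then show ?thesis by (rule right_basic_operad.operadic_poset_species_Dec_Part)
qed

end
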